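(* For every odd prime number $p$, there is an infinite set $S(p)$ of prime numbers $q$ such that, for each $q \in S(p)$, $2q$ does not lie in the image of $\phi$ and $p$ divides $2q+1$.
   Context: $\mathbb{N}^*$ denotes the set of positive integers. $\phi$ is Euler's totient function: for $n \in \mathbb{N}^*$, $\phi(n)$ is the number of integers $x$ with $1 \le x \le n$ and $\gcd(x,n) = 1$. The image of $\phi$ is $\{\phi(n) : n \in \mathbb{N}^*\}$. *)

theory Defs
  imports "HOL-Number_Theory.Number_Theory"
begin

end

theory Submission
  imports Defs "HOL-Computational_Algebra.Squarefree" "HOL-Analysis.Summation_Tests"
begin

text \<open>
  If \<open>q > 3\<close> is prime and \<open>\<phi>(n) = 2q\<close>, every prime factor \<open>r\<close> of \<open>n\<close> has \<open>r - 1\<close> dividing \<open>2q\<close>;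
  when \<open>2q + 1\<close> is composite this leaves \<open>r \<in> {2, 3}\<close>, which is impossible. So any large prime
  \<open>q \<equiv> (p - 1)/2 (mod p)\<close> will do, since then \<open>p\<close> properly divides \<open>2q + 1\<close>, and Dirichlet's theorem
  for a prime modulus supplies infinitely many of them.

  Dirichlet's theorem is proved with finite sums, along the lines of Mertens and Shapiro. A primitive
  root makes the characters \<open>\<chi>\<close> explicit. For non-principal \<open>\<chi>\<close> let
  \<open>S(\<chi>, N) = \<Sum>n\<le>N. \<chi>(n) \<Lambda>(n) / n\<close>. Expanding \<open>ln = 1 * \<Lambda>\<close> and using Chebyshev's bound,
  \<open>L(1, \<chi>) S(\<chi>, N)\<close> is bounded; if \<open>L(1, \<chi>) = 0\<close>, a Moebius inversion gives
  \<open>S(\<chi>, N) = - ln N + O(1)\<close>. Summing over all \<open>\<chi>\<close> yields a nonnegative quantity, so at most one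
  \<open>L(1, \<chi>)\<close> vanishes, and such a \<open>\<chi>\<close> must be real. Real characters are handled by Monsky's argument:
  if \<open>L(1, \<chi>) = 0\<close> then \<open>\<Sum>n. (\<Sum>d dvd n. \<chi>(d)) x^n\<close> stays bounded as \<open>x\<close> tends to 1, although its
  coefficients are nonnegative and at least 1 at squares.
\<close>

section \<open>Values of the totient function\<close>

lemma double_prime_not_totient:
  assumes q: "prime q" "q > 3" and np: "\<not> prime (2 * q + 1)" and "n > 0"
  shows "totient n \<noteq> 2 * q"
proof
  assume eq: "totient n = 2 * q"
  have small: "r = 2 \<or> r = 3" if r: "r \<in> prime_factors n" for r
  proof -
    have pr: "prime r" using r by auto
    have "totient r dvd totient n" using r \<open>n > 0\<close> by (intro totient_dvd) auto
    hence "r - 1 dvd 2 * q" using pr eq by (simp add: totient_prime)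
    then obtain b c where bc: "r - 1 = b * c" "b dvd 2" "c dvd q"
      by (rule division_decomp[THEN exE]) auto
    have "c = 1 \<or> c = q" using bc q prime_nat_iff by blast
    moreover have "b = 1 \<or> b = 2" using bc two_is_prime_nat prime_nat_iff by blast
    moreover have "r \<ge> 2" using pr prime_ge_2_nat by blast
    ultimately have "r = 2 \<or> r = 3 \<or> r = q + 1 \<or> r = 2 * q + 1" using bc(1) by auto
    moreover have "odd q" using q prime_odd_nat by auto
    hence "\<not> prime (q + 1)" using q prime_odd_nat[of "q + 1"] by auto
    ultimately show ?thesis using pr np by auto
  qed
  \<comment> \<open>In the product formula only the primes 2 and 3 can occur, and none of the
    resulting factors is divisible by a prime exceeding 3.\<close>
  have "q dvd totient n" using eq by simp
  hence "q dvd (\<Prod>r\<in>prime_factors n. r ^ (multiplicity r n - 1) * (r - 1))"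
    using \<open>n > 0\<close> by (simp add: totient_formula1)
  then obtain r where r: "r \<in> prime_factors n" "q dvd r ^ (multiplicity r n - 1) * (r - 1)"
    using q by (auto simp: prime_dvd_prod_iff)
  hence "q dvd r \<or> q dvd r - 1" using q prime_dvd_power by (auto simp: prime_dvd_mult_iff)
  hence "q \<le> 3" using small[OF r(1)] by (auto dest: dvd_imp_le)
  thus False using q by simp
qed

section \<open>Divisor sums and the Moebius function\<close>

text \<open>Substituting \<open>n = d * m\<close>, both sides run over the pairs with
  \<open>d * m\<close> at most \<open>N\<close>. Thus a summatory function of a Dirichlet
  convolution becomes an iterated sum whose inner part stops at \<open>N div d\<close>.\<close>

lemma sum_divisors_swap:
  fixes F :: "nat \<Rightarrow> nat \<Rightarrow> 'a :: comm_monoid_add"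
  shows "(\<Sum>n=1..N. \<Sum>d | d dvd n. F d (n div d)) = (\<Sum>d=1..N. \<Sum>m=1..N div d. F d m)"
proof -
  have "(\<Sum>n=1..N. \<Sum>d | d dvd n. F d (n div d)) =
          (\<Sum>(n, d)\<in>(SIGMA n:{1..N}. {d. d dvd n}). F d (n div d))"
    by (rule sum.Sigma) auto
  also have "\<dots> = (\<Sum>(d, m)\<in>(SIGMA d:{1..N}. {1..N div d}). F d m)"
    by (rule sum.reindex_bij_witness[of _ "\<lambda>(d, m). (d * m, d)" "\<lambda>(n, d). (d, n div d)"])
       (auto simp: div_le_mono Suc_le_eq div_greater_zero_iff less_eq_div_iff_mult_less_eq mult.commute
             dest: dvd_imp_le intro: dvd_pos_nat order.trans[OF dvd_imp_le])
  also have "\<dots> = (\<Sum>d=1..N. \<Sum>m=1..N div d. F d m)"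
    by (rule sum.Sigma [symmetric]) auto
  finally show ?thesis .
qed

text \<open>Unique factorization: a divisor is \<open>q ^ j * d\<close> with \<open>d dvd m\<close>,
  where \<open>j\<close> is recovered as the multiplicity of \<open>q\<close>.\<close>

lemma sum_divisors_prime_power_mult:
  fixes f :: "nat \<Rightarrow> 'a :: comm_monoid_add"
  assumes q: "prime q" and qm: "\<not> q dvd m"
  shows "(\<Sum>d | d dvd q ^ k * m. f d) = (\<Sum>d | d dvd m. \<Sum>j\<le>k. f (q ^ j * d))"
proof -
  have m0: "m > 0" using qm by (cases m) auto
  have qd: "\<not> q dvd d" if "d dvd m" for d using qm that dvd_trans by blast
  have "bij_betw (\<lambda>(d, j). q ^ j * d) ({d. d dvd m} \<times> {..k}) {d. d dvd q ^ k * m}"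
    unfolding bij_betw_def
  proof
    show "inj_on (\<lambda>(d, j). q ^ j * d) ({d. d dvd m} \<times> {..k})"
    proof (rule inj_onI, clarify)
      fix d i e j assume *: "d dvd m" "e dvd m" "q ^ i * d = q ^ j * e"
      have "multiplicity q (q ^ i * d) = i" "multiplicity q (q ^ j * e) = j"
        using q qd[OF *(1)] qd[OF *(2)] by (auto intro!: multiplicity_eqI)
      hence "i = j" using * by simp
      thus "d = e \<and> i = j" using * q by auto
    qed
    show "(\<lambda>(d, j). q ^ j * d) ` ({d. d dvd m} \<times> {..k}) = {d. d dvd q ^ k * m}"
    proof (intro equalityI subsetI)
      fix x assume "x \<in> {d. d dvd q ^ k * m}"
      hence "x dvd q ^ k * m" by simp
      then obtain a d where ad: "x = a * d" "a dvd q ^ k" "d dvd m"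
        by (rule division_decomp[THEN exE]) auto
      then obtain j where "j \<le> k" "a = q ^ j"
        using q by (auto simp: divides_primepow_nat)
      with ad show "x \<in> (\<lambda>(d, j). q ^ j * d) ` ({d. d dvd m} \<times> {..k})" by force
    qed (auto intro: mult_dvd_mono le_imp_power_dvd)
  qed
  hence "(\<Sum>d | d dvd q ^ k * m. f d) = (\<Sum>x\<in>{d. d dvd m} \<times> {..k}. f (case x of (d, j) \<Rightarrow> q ^ j * d))"
    by (rule sum.reindex_bij_betw[symmetric])
  also have "\<dots> = (\<Sum>d | d dvd m. \<Sum>j\<le>k. f (q ^ j * d))"
    using m0 by (simp add: sum.cartesian_product case_prod_unfold)
  finally show ?thesis .
qed

text \<open>The full power of a prime is split off at once, so the cofactor is prime to
  \<open>q\<close> and multiplicativity applies in the step.\<close>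

lemma prime_power_induct [consumes 1, case_names one mult]:
  assumes "n > 0" and "P 1"
    and step: "\<And>q k m. prime q \<Longrightarrow> k > 0 \<Longrightarrow> m > 0 \<Longrightarrow> \<not> q dvd m \<Longrightarrow> P m \<Longrightarrow> P (q ^ k * m)"
  shows "P (n :: nat)"
  using \<open>n > 0\<close>
proof (induction n rule: less_induct)
  case (less n)
  show ?case
  proof (cases "n = 1")
    case False
    then obtain q where q: "prime q" "q dvd n" using prime_factor_nat by blast
    define k where "k = multiplicity q n"
    obtain m where m: "n = q ^ k * m" "\<not> q dvd m"
      using multiplicity_decompose'[of n q] less.prems q unfolding k_def
      by (metis gr_implies_not0 not_prime_unit)
    have k: "k > 0" using q m by (cases k) auto
    have m0: "m > 0" using m less.prems by (cases m) auto
    have "q ^ k > 1" using q k by (intro one_less_power) (auto intro: prime_gt_Suc_0_nat)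
    hence "m < n" using m m0 by simp
    thus ?thesis using step[OF q(1) k m0 m(2)] less.IH[of m] m0 m(1) by simp
  qed (use assms in simp)
qed

definition moebius_mu :: "nat \<Rightarrow> real" where
  "moebius_mu n = (if squarefree n then (- 1) ^ card (prime_factors n) else 0)"

lemma abs_moebius_mu_le: "\<bar>moebius_mu n\<bar> \<le> 1"
  by (simp add: moebius_mu_def power_abs)

lemma moebius_mu_prime_mult:
  assumes "prime q" "\<not> q dvd d"
  shows "moebius_mu (q * d) = - moebius_mu d"
proof -
  have d0: "d \<noteq> 0" using assms by (intro notI) simp
  have "coprime q d" using assms by (simp add: prime_imp_coprime)
  hence "squarefree (q * d) \<longleftrightarrow> squarefree d"
    using assms by (auto simp: squarefree_mult_coprime squarefree_prime dest: squarefree_multD)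
  moreover have "prime_factors (q * d) = insert q (prime_factors d)"
    using assms d0 by (auto simp: prime_factors_product prime_prime_factors)
  moreover have "q \<notin> prime_factors d" using assms by auto
  ultimately show ?thesis by (simp add: moebius_mu_def)
qed

lemma moebius_mu_prime_power_mult:
  assumes "prime q" "j \<ge> 2"
  shows "moebius_mu (q ^ j * d) = 0"
proof -
  have "q ^ 2 dvd q ^ j * d" using assms by (intro dvd_mult2 le_imp_power_dvd)
  hence "\<not> squarefree (q ^ j * d)" using assms unfolding squarefree_def by (metis not_prime_unit)
  thus ?thesis by (simp add: moebius_mu_def)
qed

lemma sum_moebius_mu_divisors:
  assumes "n > 0"
  shows "(\<Sum>d | d dvd n. moebius_mu d) = (if n = 1 then 1 else 0)"
  using assms
proof (induction rule: prime_power_induct)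
  case one
  thus ?case by (simp add: moebius_mu_def)
next
  case (mult q k m)
  \<comment> \<open>Only \<open>j = 0\<close> and \<open>j = 1\<close> contribute, and they
    cancel.\<close>
  have "(\<Sum>j\<le>k. moebius_mu (q ^ j * d)) = 0" if "d dvd m" for d
  proof -
    have nd: "\<not> q dvd d" using mult that dvd_trans by blast
    have "(\<Sum>j\<le>k. moebius_mu (q ^ j * d)) = (\<Sum>j\<le>1. moebius_mu (q ^ j * d))"
      using mult by (intro sum.mono_neutral_right) (auto intro!: moebius_mu_prime_power_mult)
    also have "\<dots> = 0" using moebius_mu_prime_mult[OF mult(1) nd] by simp
    finally show ?thesis .
  qed
  moreover have "q ^ k * m \<noteq> 1" using mult by auto
  ultimately show ?case using mult by (simp add: sum_divisors_prime_power_mult)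
qed

text \<open>Moebius inversion of \<open>mangoldt_sum\<close> gives the sum of
  \<open>moebius_mu d * ln (n / d)\<close>. Splitting the logarithm leaves a multiple of
  \<open>ln n\<close> times the divisor sum of \<open>moebius_mu\<close>, which vanishes: for
  \<open>n = 1\<close> because \<open>ln 1 = 0\<close>, otherwise because the divisor sum is
  0.\<close>

lemma mangoldt_eq_sum_moebius_mu_ln:
  assumes "n > 0"
  shows "(mangoldt n :: real) = - (\<Sum>d | d dvd n. moebius_mu d * ln (real d))"
proof -
  have fin: "finite {d. d dvd n}" using assms by simp
  have swap: "b dvd n \<and> a dvd n div b" if "a dvd n" "b dvd n div a" for a b
  proof -
    from that obtain k l where "n = a * k" "n div a = b * l" unfolding dvd_def by blast
    hence "n = a * (b * l)" "b \<noteq> 0" using assms by (auto split: if_splits)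
    thus ?thesis by (simp add: mult.left_commute)
  qed
  have "(\<Sum>d | d dvd n. moebius_mu d * ln (real (n div d))) =
        (\<Sum>d | d dvd n. \<Sum>e | e dvd n div d. moebius_mu d * mangoldt e)"
  proof (rule sum.cong[OF refl])
    fix d assume "d \<in> {d. d dvd n}"
    hence "n div d \<noteq> 0" using assms by (auto simp: dvd_div_eq_0_iff)
    thus "moebius_mu d * ln (real (n div d)) = (\<Sum>e | e dvd n div d. moebius_mu d * mangoldt e)"
      using mangoldt_sum[of "n div d", where 'a = real] by (simp add: sum_distrib_left[symmetric])
  qed
  also have "\<dots> = (\<Sum>(d, e)\<in>(SIGMA d:{d. d dvd n}. {e. e dvd n div d}). moebius_mu d * mangoldt e)"
    using assms by (intro sum.Sigma) (auto simp: dvd_div_eq_0_iff)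
  \<comment> \<open>The index set consists of the pairs with \<open>d * e dvd n\<close>, a condition
    symmetric in \<open>d\<close> and \<open>e\<close>.\<close>
  also have "\<dots> = (\<Sum>(e, d)\<in>(SIGMA e:{d. d dvd n}. {d. d dvd n div e}). moebius_mu d * mangoldt e)"
    by (rule sum.reindex_bij_witness[of _ "\<lambda>(a, b). (b, a)" "\<lambda>(a, b). (b, a)"])
       (use assms swap in auto)
  also have "\<dots> = (\<Sum>e | e dvd n. \<Sum>d | d dvd n div e. moebius_mu d * mangoldt e)"
    using assms by (intro sum.Sigma[symmetric]) (auto simp: dvd_div_eq_0_iff)
  also have "\<dots> = (\<Sum>e | e dvd n. if e = n then mangoldt e else 0)"
  proof (rule sum.cong[OF refl])
    fix e assume e: "e \<in> {e. e dvd n}"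
    hence "n div e > 0" using assms by (auto simp: div_greater_zero_iff dvd_imp_le intro: Nat.gr0I)
    hence "(\<Sum>d | d dvd n div e. moebius_mu d * mangoldt e) = (if n div e = 1 then mangoldt e else 0)"
      by (simp add: sum_distrib_right[symmetric] sum_moebius_mu_divisors)
    moreover have "n div e = 1 \<longleftrightarrow> e = n" using e assms by auto
    ultimately show "(\<Sum>d | d dvd n div e. moebius_mu d * mangoldt e) = (if e = n then mangoldt e else 0)"
      by simp
  qed
  also have "\<dots> = mangoldt n" using fin by simp
  finally have 1: "mangoldt n = (\<Sum>d | d dvd n. moebius_mu d * ln (real (n div d)))" ..
  also have "\<dots> = (\<Sum>d | d dvd n. moebius_mu d * ln (real n) - moebius_mu d * ln (real d))"
  proof (rule sum.cong[OF refl])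
    fix d assume "d \<in> {d. d dvd n}"
    hence "d dvd n" "d > 0" using assms by (auto intro: Nat.gr0I)
    thus "moebius_mu d * ln (real (n div d)) = moebius_mu d * ln (real n) - moebius_mu d * ln (real d)"
      using assms by (simp add: real_of_nat_div ln_div algebra_simps)
  qed
  also have "\<dots> = (\<Sum>d | d dvd n. moebius_mu d) * ln (real n) - (\<Sum>d | d dvd n. moebius_mu d * ln (real d))"
    by (simp add: sum_subtractf sum_distrib_right)
  finally show ?thesis using assms by (simp add: sum_moebius_mu_divisors split: if_splits)
qed

section \<open>Chebyshev and Mertens bounds\<close>

lemma ln_fact_eq_sum_ln: "ln (fact N :: real) = (\<Sum>n=1..N. ln (real n))"
  by (induction N) (simp_all add: ln_mult)

lemma ln_fact_eq_sum_mangoldt: "ln (fact N :: real) = (\<Sum>d=1..N. mangoldt d * real (N div d))"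
proof -
  have "ln (fact N :: real) = (\<Sum>n=1..N. \<Sum>d | d dvd n. mangoldt d)"
    unfolding ln_fact_eq_sum_ln by (intro sum.cong refl) (simp add: mangoldt_sum)
  also have "\<dots> = (\<Sum>d=1..N. mangoldt d * real (N div d))"
    using sum_divisors_swap[of "\<lambda>d m. mangoldt d :: real" N] by (simp add: mult.commute[of "mangoldt _"])
  finally show ?thesis .
qed

lemma ln_fact_le: "ln (fact N :: real) \<le> real N * ln (real N)"
proof (cases "N = 0")
  case False
  have "(\<Sum>n=1..N. ln (real n)) \<le> (\<Sum>n=1..N. ln (real N))"
    by (intro sum_mono) auto
  thus ?thesis by (simp add: ln_fact_eq_sum_ln)
qed auto

text \<open>The number \<open>N ^ N / fact N\<close> is a single term of the exponential series for
  \<open>exp N\<close>.\<close>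

lemma ln_fact_ge: "ln (fact N :: real) \<ge> real N * ln (real N) - real N"
proof (cases "N = 0")
  case False
  have "real N ^ N / fact N \<le> (\<Sum>n. real N ^ n / fact n)"
    using summable_exp[of "real N"]
    by (intro order.trans[OF _ sum_le_suminf[of _ "{N}"]]) (auto simp: field_simps)
  also have "\<dots> = exp (real N)" by (simp add: exp_def scaleR_conv_of_real field_simps)
  finally have "ln (real N ^ N / fact N) \<le> real N"
    using False by (subst ln_exp[symmetric], subst ln_le_cancel_iff) auto
  thus ?thesis using False by (simp add: ln_div ln_realpow)
qed auto

text \<open>Chebyshev's argument: the central binomial coefficient is at most
  \<open>2 ^ (2 * n)\<close>, and its logarithm dominates the weight of \<open>mangoldt\<close> on
  the integers between \<open>n\<close> and \<open>2 * n\<close>. Repeated halving then gives the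
  linear bound.\<close>

lemma sum_mangoldt_le: "(\<Sum>n=1..N. mangoldt n) \<le> 4 * real N"
proof (induction N rule: less_induct)
  case (less N)
  let ?psi = "\<lambda>N. \<Sum>n=1..N. mangoldt n :: real"
  have double: "?psi (2 * n) \<le> ?psi n + 2 * real n" for n
  proof -
    have "ln (fact (2 * n) :: real) - 2 * ln (fact n) = ln (real (2 * n choose n))"
      using binomial_fact[of n "2 * n", where 'a = real] by (simp add: ln_div ln_mult)
    also have "\<dots> \<le> ln (2 ^ (2 * n))"
    proof (subst ln_le_cancel_iff)
      have "real (2 * n choose n) \<le> real (2 ^ (2 * n))"
        using binomial_le_pow2 of_nat_le_iff by blast
      thus "real (2 * n choose n) \<le> 2 ^ (2 * n)" by simp
    qed auto
    also have "\<dots> \<le> 2 * real n" using ln_2_less_1 by (simp add: ln_realpow mult_left_le)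
    finally have le: "ln (fact (2 * n) :: real) - 2 * ln (fact n) \<le> 2 * real n" .
    have "ln (fact n :: real) = (\<Sum>d=1..2*n. mangoldt d * real (n div d))"
      unfolding ln_fact_eq_sum_mangoldt by (rule sum.mono_neutral_left) auto
    hence "ln (fact (2 * n) :: real) - 2 * ln (fact n) =
             (\<Sum>d=1..2*n. mangoldt d * (real (2 * n div d) - 2 * real (n div d)))"
      unfolding ln_fact_eq_sum_mangoldt[of "2 * n"]
      by (simp add: algebra_simps sum_subtractf sum_distrib_left)
    \<comment> \<open>The difference of integer quotients is never negative, and it equals 1 when
      \<open>n < d\<close> and \<open>d\<close> is at most \<open>2 * n\<close>.\<close>
    also have "\<dots> \<ge> (\<Sum>d=1..2*n. mangoldt d * (if d > n then 1 else 0))"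
    proof (intro sum_mono mult_left_mono mangoldt_nonneg)
      fix d assume d: "d \<in> {1..2*n}"
      have "2 * (n div d) \<le> 2 * n div d"
        using d div_times_less_eq_dividend[of n d]
        by (simp add: less_eq_div_iff_mult_less_eq mult.assoc)
      moreover have "2 * n div d = 1" "n div d = 0" if "d > n"
        using d that by (auto intro: div_nat_eqI)
      ultimately show "(if d > n then 1 else 0) \<le> real (2 * n div d) - 2 * real (n div d)"
        using of_nat_mono[of "2 * (n div d)" "2 * n div d", where 'a = real] by auto
    qed
    also have "(\<Sum>d=1..2*n. mangoldt d * (if d > n then 1 else 0)) = ?psi (2 * n) - ?psi n"
    proof -
      have "{1..2 * n} = {1..n} \<union> {n<..2*n}" by auto
      hence "sum f {1..2 * n} = sum f {1..n} + sum f {n<..2*n}" for f :: "nat \<Rightarrow> real"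
        by (simp add: sum.union_disjoint ivl_disj_int)
      thus ?thesis by simp
    qed
    finally show ?thesis using le by linarith
  qed
  consider "N \<le> 1" | n where "N = 2 * n" "n \<ge> 1" | n where "N = 2 * n + 1" "n \<ge> 1"
  proof (cases "N \<le> 1")
    case False
    hence "N = 2 * (N div 2) \<or> N = 2 * (N div 2) + 1" "N div 2 \<ge> 1" by presburger+
    thus ?thesis using that(2)[of "N div 2"] that(3)[of "N div 2"] by blast
  qed (use that in blast)
  thus ?case
  proof cases
    case 1
    thus ?thesis by (cases N) auto
  next
    case (2 n)
    thus ?thesis using double[of n] less.IH[of n] by simp
  next
    case (3 n)
    \<comment> \<open>An odd \<open>N\<close> is rounded up: this yields \<open>6 * n + 6\<close>,
      which is at most \<open>4 * N = 8 * n + 4\<close> since \<open>n\<close> is at least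
      1.\<close>
    have "?psi N \<le> ?psi (2 * (n + 1))"
      using 3 by (intro sum_mono2) (auto simp: mangoldt_nonneg)
    thus ?thesis using 3 double[of "n + 1"] less.IH[of "n + 1"] by simp
  qed
qed

lemma sum_mangoldt_over_ge:
  assumes "N > 0"
  shows "ln (real N) - 1 \<le> (\<Sum>n=1..N. mangoldt n / real n)"
proof -
  have "real N * ln (real N) - real N \<le> (\<Sum>d=1..N. mangoldt d * real (N div d))"
    using ln_fact_ge[of N] by (simp add: ln_fact_eq_sum_mangoldt)
  also have "\<dots> \<le> (\<Sum>d=1..N. mangoldt d * (real N / real d))"
    by (intro sum_mono mult_left_mono mangoldt_nonneg of_nat_div_le_of_nat)
  also have "\<dots> = real N * (\<Sum>n=1..N. mangoldt n / real n)"
    by (simp add: sum_distrib_left mult_ac)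
  finally have "real N * (ln (real N) - 1) \<le> real N * (\<Sum>n=1..N. mangoldt n / real n)"
    by (simp add: algebra_simps)
  thus ?thesis using assms by simp
qed

text \<open>Replacing \<open>N / d\<close> by \<open>N div d\<close> costs less than 1 per unit of
  weight, in total at most the Chebyshev sum; this is the origin of the 4.\<close>

lemma sum_mangoldt_over_le:
  assumes "N > 0"
  shows "(\<Sum>n=1..N. mangoldt n / real n) \<le> ln (real N) + 4"
proof -
  have "real N * (\<Sum>n=1..N. mangoldt n / real n) = (\<Sum>d=1..N. mangoldt d * (real N / real d))"
    by (simp add: sum_distrib_left mult_ac)
  also have "\<dots> \<le> (\<Sum>d=1..N. mangoldt d * (real (N div d) + 1))"
  proof (intro sum_mono mult_left_mono mangoldt_nonneg)
    fix d
    show "real N / real d \<le> real (N div d) + 1"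
      using floor_divide_of_nat_eq[of N d, where 'a = real] by linarith
  qed
  also have "\<dots> = ln (fact N) + (\<Sum>n=1..N. mangoldt n)"
    by (simp add: ln_fact_eq_sum_mangoldt algebra_simps sum.distrib)
  also have "\<dots> \<le> real N * (ln (real N) + 4)"
    using ln_fact_le[of N] sum_mangoldt_le[of N] by (simp add: algebra_simps)
  finally show ?thesis using assms by simp
qed

section \<open>Contribution of proper prime powers\<close>

lemma sum_power_from_2_le:
  fixes x :: real
  assumes "0 \<le> x" "x \<le> 1 / 2"
  shows "(\<Sum>k=2..N. x ^ k) \<le> 2 * x\<^sup>2"
proof (cases "N \<ge> 1")
  case True
  \<comment> \<open>The subtracted term strengthens the claim for induction: it absorbs the next
    power exactly because \<open>2 * x\<close> is at most 1.\<close>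
  hence "(\<Sum>k=2..N. x ^ k) \<le> 2 * x\<^sup>2 - 2 * x ^ (N + 1)"
  proof (induction N rule: dec_induct)
    case (step n)
    have "x * x ^ (n + 1) \<le> 1 / 2 * x ^ (n + 1)"
      using assms by (intro mult_right_mono) auto
    thus ?case using step by simp
  qed (simp add: power2_eq_square)
  moreover have "0 \<le> x ^ (N + 1)" using assms by simp
  ultimately show ?thesis by linarith
qed simp

text \<open>Powers \<open>q ^ k\<close> with \<open>k\<close> at least 2 contribute on the order of
  \<open>ln q / q ^ 2\<close> for each \<open>q\<close>, which is summable. Hence weights on prime
  powers can later be traded for weights on primes at bounded cost.\<close>

lemma sum_mangoldt_over_nonprime_bounded:
  "\<exists>C. \<forall>N. (\<Sum>n | n \<in> {1..N} \<and> \<not> prime n. mangoldt n / real n) \<le> C"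
proof -
  have sm: "summable (\<lambda>n. 4 * real n powr (- 3 / 2))"
    by (intro summable_mult) (simp add: summable_real_powr_iff)
  have "(\<Sum>n | n \<in> {1..N} \<and> \<not> prime n. mangoldt n / real n) \<le> (\<Sum>n. 4 * real n powr (- 3 / 2))" for N
  proof -
    have "(\<Sum>n | n \<in> {1..N} \<and> \<not> prime n. mangoldt n / real n) =
          (\<Sum>n | n \<in> {1..N} \<and> \<not> prime n \<and> primepow n. mangoldt n / real n)"
      by (rule sum.mono_neutral_right) (auto simp: mangoldt_def)
    \<comment> \<open>The base is allowed to be any integer, since the extra terms are nonnegative
      and the series still converges.\<close>
    also have "\<dots> \<le> (\<Sum>(q, k)\<in>{2..N} \<times> {2..N}. ln (real q) * (1 / real q) ^ k)"
    proof (rule sum_le_included[where i = "\<lambda>(q, k). q ^ k"])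
      show "\<forall>x\<in>{n. n \<in> {1..N} \<and> \<not> prime n \<and> primepow n}.
              \<exists>y\<in>{2..N} \<times> {2..N}. (case y of (q, k) \<Rightarrow> q ^ k) = x \<and>
                mangoldt x / real x \<le> (case y of (q, k) \<Rightarrow> ln (real q) * (1 / real q) ^ k)"
      proof
        fix x assume x: "x \<in> {n. n \<in> {1..N} \<and> \<not> prime n \<and> primepow n}"
        then obtain q k where qk: "prime q" "k > 0" "x = q ^ k" by (auto simp: primepow_def)
        have "k \<noteq> 1" using x qk by auto
        hence k: "k \<ge> 2" using qk by simp
        have q: "q \<ge> 2" using qk prime_ge_2_nat by blast
        have "q \<le> x" using qk q by (simp add: self_le_power)
        moreover have "k < x" using qk q by (metis less_exp order_less_le_trans power_mono zero_le)
        ultimately have "(q, k) \<in> {2..N} \<times> {2..N}" using x k q by auto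
        moreover have "mangoldt x / real x = ln (real q) * (1 / real q) ^ k"
          using qk by (simp add: power_divide)
        ultimately show "\<exists>y\<in>{2..N} \<times> {2..N}. (case y of (q, k) \<Rightarrow> q ^ k) = x \<and>
                mangoldt x / real x \<le> (case y of (q, k) \<Rightarrow> ln (real q) * (1 / real q) ^ k)"
          using qk by (intro bexI[of _ "(q, k)"]) auto
      qed
    qed auto
    also have "\<dots> = (\<Sum>q=2..N. ln (real q) * (\<Sum>k=2..N. (1 / real q) ^ k))"
      by (simp add: sum.cartesian_product[symmetric] sum_distrib_left)
    also have "\<dots> \<le> (\<Sum>q=2..N. 4 * real q powr (- 3 / 2))"
    proof (rule sum_mono)
      fix q assume "q \<in> {2..N}"
      hence q: "q \<ge> 2" by simp
      have "ln (real q) = 2 * ln (sqrt (real q))" using q by (simp add: ln_sqrt)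
      also have "\<dots> \<le> 2 * sqrt (real q)"
        using q ln_le_minus_one[of "sqrt (real q)"] by simp
      finally have "ln (real q) * (\<Sum>k=2..N. (1 / real q) ^ k) \<le> (2 * sqrt (real q)) * (2 * (1 / real q)\<^sup>2)"
        using q by (intro mult_mono sum_power_from_2_le sum_nonneg) (auto simp: field_simps)
      also have "\<dots> = 4 * (real q powr (1 / 2) * real q powr (- 2))"
        using q by (simp add: powr_half_sqrt powr_minus powr_numeral field_simps)
      also have "\<dots> = 4 * real q powr (- 3 / 2)"
        by (simp add: powr_add[symmetric])
      finally show "ln (real q) * (\<Sum>k=2..N. (1 / real q) ^ k) \<le> 4 * real q powr (- 3 / 2)" .
    qed
    also have "\<dots> \<le> (\<Sum>n. 4 * real n powr (- 3 / 2))"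
      by (rule sum_le_suminf[OF sm]) auto
    finally show ?thesis .
  qed
  thus ?thesis by blast
qed

section \<open>Partial summation and limits with explicit rates\<close>

text \<open>Abel summation. Blocks starting after \<open>M\<close> are differences of two partial
  sums, hence the factor 2. Monotonicity is required only beyond \<open>M\<close>, which suits
  weights that decrease from some point on.\<close>

lemma norm_sum_mult_antimono_le:
  fixes f :: "nat \<Rightarrow> complex" and g :: "nat \<Rightarrow> real"
  assumes bdd: "\<And>N. norm (\<Sum>n=1..N. f n) \<le> B"
    and nonneg: "\<And>n. n > M \<Longrightarrow> g n \<ge> 0"
    and decr: "\<And>n. n > M \<Longrightarrow> g (Suc n) \<le> g n"
  shows "norm (\<Sum>n\<in>{M<..N}. f n * of_real (g n)) \<le> 2 * B * g (Suc M)"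
proof (cases "N > M")
  case False
  thus ?thesis using nonneg[of "Suc M"] bdd[of 0] by simp
next
  case True
  have B0: "B \<ge> 0" using bdd[of 0] by simp
  define T where "T = (\<lambda>N. \<Sum>n\<in>{M<..N}. f n)"
  have T: "norm (T N) \<le> 2 * B" if "N \<ge> M" for N
  proof -
    have "{1..N} = {1..M} \<union> {M<..N}" using that by auto
    hence "(\<Sum>n=1..N. f n) = (\<Sum>n=1..M. f n) + T N"
      by (simp add: T_def sum.union_disjoint ivl_disj_int)
    thus ?thesis using bdd[of N] bdd[of M] norm_triangle_ineq4[of "\<Sum>n=1..N. f n" "\<Sum>n=1..M. f n"]
      by simp
  qed
  have insert: "{M<..Suc n} = insert (Suc n) {M<..n}" if "n \<ge> M" for n using that by auto
  from True have "Suc M \<le> N" by simp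
  \<comment> \<open>With the boundary term \<open>T N * g N\<close> removed, the increments are
    \<open>T n * (g n - g (Suc n))\<close>, and their bounds telescope.\<close>
  hence *: "norm ((\<Sum>n\<in>{M<..N}. f n * of_real (g n)) - T N * of_real (g N)) \<le> 2 * B * (g (Suc M) - g N)"
  proof (induction N rule: dec_induct)
    case base
    thus ?case by (simp add: T_def insert)
  next
    case (step n)
    have "(\<Sum>n\<in>{M<..Suc n}. f n * of_real (g n)) - T (Suc n) * of_real (g (Suc n)) =
          ((\<Sum>n\<in>{M<..n}. f n * of_real (g n)) - T n * of_real (g n)) + T n * of_real (g n - g (Suc n))"
      using step by (simp add: T_def insert algebra_simps)
    also have "norm \<dots> \<le> 2 * B * (g (Suc M) - g n) + 2 * B * (g n - g (Suc n))"
    proof (rule norm_triangle_mono[OF step.IH])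
      show "norm (T n * of_real (g n - g (Suc n))) \<le> 2 * B * (g n - g (Suc n))"
        using step B0 T[of n] decr[of n] unfolding norm_mult norm_of_real by (intro mult_mono) auto
    qed
    finally show ?case by (simp add: algebra_simps)
  qed
  have "norm (T N * of_real (g N)) \<le> 2 * B * g N"
    using True B0 T[of N] nonneg[of N] unfolding norm_mult norm_of_real by (intro mult_mono) auto
  thus ?thesis
    using * norm_triangle_sub[of "\<Sum>n\<in>{M<..N}. f n * of_real (g n)" "T N * of_real (g N)"]
    by (simp add: algebra_simps)
qed

lemma limit_from_increment_bound:
  fixes S :: "nat \<Rightarrow> 'a :: banach"
  assumes inc: "\<And>M N. M \<le> N \<Longrightarrow> norm (S N - S M) \<le> e M" and e: "e \<longlonglongrightarrow> 0"
  shows "convergent S" and "norm (S M - lim S) \<le> e M"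
proof -
  have "Cauchy S"
  proof (rule CauchyI')
    fix \<epsilon> :: real assume "\<epsilon> > 0"
    then obtain M0 where "\<And>M. M \<ge> M0 \<Longrightarrow> norm (e M) < \<epsilon>"
      using LIMSEQ_D[OF e] by (metis diff_zero)
    hence "norm (S m - S n) < \<epsilon>" if "m \<ge> M0" "n > m" for m n
      using inc[of m n] that norm_minus_commute[of "S m" "S n"] by fastforce
    thus "\<exists>M. \<forall>m\<ge>M. \<forall>n>m. dist (S m) (S n) < \<epsilon>" unfolding dist_norm by blast
  qed
  thus conv: "convergent S" by (rule Cauchy_convergent)
  hence "(\<lambda>N. norm (S M - S N)) \<longlonglongrightarrow> norm (S M - lim S)"
    by (intro tendsto_norm tendsto_diff tendsto_const) (simp add: convergent_LIMSEQ_iff)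
  thus "norm (S M - lim S) \<le> e M"
    by (rule LIMSEQ_le_const2) (use inc[of M] in \<open>auto simp: norm_minus_commute\<close>)
qed

section \<open>Roots of unity and periodic sums\<close>

lemma power_eq_power_if_cong:
  fixes z :: "'a :: monoid_mult"
  assumes "z ^ k = 1" "[a = b] (mod k)"
  shows "z ^ a = z ^ b"
proof -
  have "z ^ c = z ^ (c mod k)" for c
    by (metis assms(1) div_mult_mod_eq mult.commute mult_1 power_add power_mult power_one)
  thus ?thesis using assms(2) by (metis cong_def)
qed

lemma sum_powers_root_of_unity:
  fixes w :: "'a :: field"
  assumes "w ^ k = 1"
  shows "(\<Sum>j<k. w ^ j) = (if w = 1 then of_nat k else 0)"
  using assms by (simp add: sum_gp_strict)

text \<open>Complete periods cancel, leaving fewer than \<open>k\<close> terms of norm at most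
  1.\<close>

lemma norm_sum_periodic_le:
  fixes f :: "nat \<Rightarrow> complex"
  assumes "k > 0" and period: "\<And>n. f (n + k) = f n" and norm1: "\<And>n. norm (f n) \<le> 1"
    and sum0: "(\<Sum>n=1..k. f n) = 0"
  shows "norm (\<Sum>n=1..N. f n) \<le> real k"
proof (induction N rule: less_induct)
  case (less N)
  show ?case
  proof (cases "N < k")
    case True
    have "norm (\<Sum>n=1..N. f n) \<le> (\<Sum>n=1..N. 1)" by (intro sum_norm_le norm1)
    thus ?thesis using True by simp
  next
    case False
    have "(\<Sum>n=1..N. f n) = (\<Sum>n=1..k. f n) + (\<Sum>n=k+1..N. f n)"
      using False sum.ub_add_nat[of 1 k f "N - k"] by simp
    also have "(\<Sum>n=k+1..N. f n) = (\<Sum>n=1..N-k. f (n + k))"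
      using sum.shift_bounds_cl_nat_ivl[of f 1 k "N - k"] False by (simp add: add.commute)
    finally have "(\<Sum>n=1..N. f n) = (\<Sum>n=1..N-k. f n)" using sum0 by (simp add: period)
    thus ?thesis using less.IH[of "N - k"] False \<open>k > 0\<close> by simp
  qed
qed

lemma ln_real_of_nat_unbounded: "\<exists>N>0. ln (real N) > C"
proof -
  obtain N :: nat where N: "real N > exp C" using reals_Archimedean2 by blast
  hence "N > 0" using exp_gt_zero[of C] by (cases N) auto
  moreover have "ln (real N) > C" using N \<open>N > 0\<close> by (metis exp_gt_zero ln_exp ln_less_cancel_iff of_nat_0_less_iff)
  ultimately show ?thesis by blast
qed

section \<open>Completely multiplicative functions with bounded partial sums\<close>

definition char_harmonic_sum :: "(nat \<Rightarrow> complex) \<Rightarrow> nat \<Rightarrow> complex" where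
  "char_harmonic_sum chi N = (\<Sum>n=1..N. chi n / of_nat n)"

text \<open>The value is meaningful only when the partial sums converge;
  \<open>harmonic_sum_tendsto\<close> shows this under bounded character sums.\<close>

definition L_one :: "(nat \<Rightarrow> complex) \<Rightarrow> complex" where
  "L_one chi = lim (char_harmonic_sum chi)"

definition char_mangoldt_sum :: "(nat \<Rightarrow> complex) \<Rightarrow> nat \<Rightarrow> complex" where
  "char_mangoldt_sum chi N = (\<Sum>n=1..N. chi n * mangoldt n / of_nat n)"

text \<open>An abstract non-principal character: the uniform bound \<open>B\<close> on partial sums
  stands in for periodicity and orthogonality, and it fails for the principal character.\<close>

locale bounded_character =
  fixes chi :: "nat \<Rightarrow> complex" and B :: real
  assumes one: "chi 1 = 1"
    and mult: "chi (m * n) = chi m * chi n"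
    and norm_le: "norm (chi n) \<le> 1"
    and norm_sum_le: "norm (\<Sum>n=1..N. chi n) \<le> B"
begin

abbreviation "harmonic_sum \<equiv> char_harmonic_sum chi"
abbreviation "L1 \<equiv> L_one chi"
abbreviation "mangoldt_sum \<equiv> char_mangoldt_sum chi"

lemma B_nonneg: "B \<ge> 0"
  using norm_sum_le[of 0] by simp

lemma harmonic_sum_increment:
  assumes "M \<le> N"
  shows "norm (harmonic_sum N - harmonic_sum M) \<le> 2 * B / real (M + 1)"
proof -
  have "{1..N} = {1..M} \<union> {M<..N}" using assms by auto
  hence "harmonic_sum N - harmonic_sum M = (\<Sum>n\<in>{M<..N}. chi n * of_real (1 / real n))"
    by (simp add: char_harmonic_sum_def sum.union_disjoint ivl_disj_int)
  also have "norm \<dots> \<le> 2 * B * (1 / real (Suc M))"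
    by (rule norm_sum_mult_antimono_le[OF norm_sum_le]) (auto simp: field_simps)
  finally show ?thesis by simp
qed

lemma tail_tendsto_0: "(\<lambda>M. 2 * B / real (M + 1)) \<longlonglongrightarrow> 0"
  using tendsto_mult[OF tendsto_const[of "2 * B"] LIMSEQ_inverse_real_of_nat]
  by (simp add: divide_inverse add.commute)

lemma harmonic_sum_tendsto: "harmonic_sum \<longlonglongrightarrow> L1"
  using limit_from_increment_bound(1)[OF harmonic_sum_increment tail_tendsto_0]
  by (simp add: L_one_def convergent_LIMSEQ_iff)

lemma harmonic_sum_minus_L1: "norm (harmonic_sum N - L1) \<le> 2 * B / real (N + 1)"
  unfolding L_one_def by (rule limit_from_increment_bound(2)[OF harmonic_sum_increment tail_tendsto_0])

text \<open>The error is linear in \<open>d\<close>, so it cancels the denominator in weights such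
  as \<open>mangoldt d / d\<close> and leaves sums controlled by Chebyshev's bound or
  \<open>ln_fact_ge\<close>.\<close>

lemma harmonic_sum_div_minus_L1:
  assumes "d \<in> {1..N}"
  shows "norm (harmonic_sum (N div d) - L1) \<le> 2 * B * (real d / real N)"
proof -
  have "real N / real d \<le> real (N div d + 1)"
    using floor_divide_of_nat_eq[of N d, where 'a = real] by linarith
  hence "2 * B / real (N div d + 1) \<le> 2 * B / (real N / real d)"
    using assms B_nonneg by (intro divide_left_mono) auto
  thus ?thesis using harmonic_sum_minus_L1[of "N div d"] by simp
qed

lemma sum_ln_bounded: "\<exists>C. \<forall>N. norm (\<Sum>n=1..N. chi n * of_real (ln (real n) / real n)) \<le> C"
proof -
  define g where "g = (\<lambda>n. ln (real n) / real n)"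
  \<comment> \<open>The function \<open>ln x / x\<close> decreases only from \<open>exp 1\<close>
    on, so the indices 1 and 2 are treated separately.\<close>
  have decr: "g (Suc n) \<le> g n" if "n > 2" for n
    unfolding g_def by (rule ln_x_over_x_mono) (use that exp_le in auto)
  have g0: "g n \<ge> 0" for n by (cases "n = 0") (auto simp: g_def)
  have "norm (\<Sum>n=1..N. chi n * of_real (g n)) \<le> g 1 + g 2 + 2 * B * g 3" for N
  proof -
    have "norm (\<Sum>n\<in>{1..2}. chi n * of_real (g n)) \<le> (\<Sum>n\<in>{1..2}. g n)"
      by (intro sum_norm_le) (use norm_le g0 in \<open>auto simp: norm_mult intro: mult_left_le_one_le\<close>)
    also have "\<dots> = g 1 + g 2" by (simp add: numeral_2_eq_2)
    finally have 1: "norm (\<Sum>n\<in>{1..2}. chi n * of_real (g n)) \<le> g 1 + g 2" .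
    have 2: "norm (\<Sum>n\<in>{2<..N}. chi n * of_real (g n)) \<le> 2 * B * g 3"
      using norm_sum_mult_antimono_le[OF norm_sum_le, of 2 g N] decr g0 by (simp add: numeral_3_eq_3)
    show ?thesis
    proof (cases "N \<ge> 2")
      case True
      hence "{1..N} = {1..2} \<union> {2<..N}" by auto
      hence "(\<Sum>n=1..N. chi n * of_real (g n)) =
               (\<Sum>n\<in>{1..2}. chi n * of_real (g n)) + (\<Sum>n\<in>{2<..N}. chi n * of_real (g n))"
        by (simp add: sum.union_disjoint ivl_disj_int)
      thus ?thesis using norm_triangle_mono[OF 1 2] by simp
    next
      case False
      hence "N = 0 \<or> N = 1" by auto
      thus ?thesis using g0 B_nonneg one by (auto simp: norm_mult g_def)
    qed
  qed
  thus ?thesis unfolding g_def by blast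
qed

lemma L1_mult_mangoldt_sum_bounded: "\<exists>C. \<forall>N. norm (L1 * mangoldt_sum N) \<le> C"
proof -
  obtain C where C: "\<And>N. norm (\<Sum>n=1..N. chi n * of_real (ln (real n) / real n)) \<le> C"
    using sum_ln_bounded by blast
  have "norm (L1 * mangoldt_sum N) \<le> C + 8 * B" for N
  proof (cases "N = 0")
    case True
    thus ?thesis using C[of 0] B_nonneg by (simp add: char_mangoldt_sum_def)
  next
    case False
    let ?H = "\<Sum>n=1..N. chi n * of_real (ln (real n) / real n)"
    have "?H = (\<Sum>n=1..N. \<Sum>d | d dvd n. chi d * mangoldt d / of_nat d * (chi (n div d) / of_nat (n div d)))"
    proof (rule sum.cong[OF refl])
      fix n assume n: "n \<in> {1..N}"
      have "chi n * of_real (ln (real n) / real n) = (\<Sum>d | d dvd n. chi n * mangoldt d / of_nat n)"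
        using n Prime_Powers.mangoldt_sum[of n, where 'a = complex]
        by (simp add: sum_divide_distrib[symmetric] sum_distrib_left[symmetric])
      also have "\<dots> = (\<Sum>d | d dvd n. chi d * mangoldt d / of_nat d * (chi (n div d) / of_nat (n div d)))"
      proof (rule sum.cong[OF refl])
        fix d assume "d \<in> {d. d dvd n}"
        then obtain k where k: "n = d * k" by auto
        hence "d > 0" using n by (auto intro: Nat.gr0I)
        thus "chi n * mangoldt d / of_nat n = chi d * mangoldt d / of_nat d * (chi (n div d) / of_nat (n div d))"
          using k by (simp add: mult)
      qed
      finally show "chi n * of_real (ln (real n) / real n) = \<dots>" .
    qed
    also have "\<dots> = (\<Sum>d=1..N. chi d * mangoldt d / of_nat d * harmonic_sum (N div d))"
      by (subst sum_divisors_swap) (simp add: char_harmonic_sum_def sum_distrib_left)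
    \<comment> \<open>Each inner partial sum is written as \<open>L1\<close> plus an error. The
      errors add up to at most \<open>2 * B / N\<close> times the Chebyshev sum, that is
      \<open>8 * B\<close>.\<close>
    finally have "L1 * mangoldt_sum N = ?H -
                    (\<Sum>d=1..N. chi d * mangoldt d / of_nat d * (harmonic_sum (N div d) - L1))"
      by (simp add: char_mangoldt_sum_def right_diff_distrib diff_divide_distrib sum_subtractf
                    sum_distrib_left mult_ac)
    also have "norm \<dots> \<le> C + 8 * B"
    proof (rule norm_triangle_le_diff[OF add_mono[OF C]])
      have "norm (\<Sum>d=1..N. chi d * mangoldt d / of_nat d * (harmonic_sum (N div d) - L1)) \<le>
            (\<Sum>d=1..N. 1 * mangoldt d / real d * (2 * B * (real d / real N)))"
      proof (intro sum_norm_le)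
        fix d assume d: "d \<in> {1..N}"
        show "norm (chi d * mangoldt d / of_nat d * (harmonic_sum (N div d) - L1)) \<le>
                1 * mangoldt d / real d * (2 * B * (real d / real N))"
          unfolding norm_mult norm_divide norm_mangoldt norm_of_nat
          using harmonic_sum_div_minus_L1[OF d] norm_le[of d]
          by (intro mult_mono divide_right_mono mangoldt_nonneg) (auto simp: mangoldt_nonneg)
      qed
      also have "\<dots> = 2 * B / real N * (\<Sum>d=1..N. mangoldt d)"
        by (simp add: sum_distrib_left sum_divide_distrib mult_ac)
      also have "\<dots> \<le> 2 * B / real N * (4 * real N)"
        using B_nonneg by (intro mult_left_mono sum_mangoldt_le) auto
      finally show "norm (\<Sum>d=1..N. chi d * mangoldt d / of_nat d * (harmonic_sum (N div d) - L1)) \<le> 8 * B"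
        using False by simp
    qed
    finally show ?thesis .
  qed
  thus ?thesis by blast
qed

lemma mangoldt_sum_bounded:
  assumes "L1 \<noteq> 0"
  shows "\<exists>C. \<forall>N. norm (mangoldt_sum N) \<le> C"
proof -
  obtain C where "\<And>N. norm (L1 * mangoldt_sum N) \<le> C"
    using L1_mult_mangoldt_sum_bounded by blast
  hence "\<And>N. norm (mangoldt_sum N) \<le> C / norm L1"
    using assms by (simp add: norm_mult field_simps)
  thus ?thesis by blast
qed

text \<open>The divisor sum of \<open>moebius_mu d * ln (N / d)\<close> is
  \<open>mangoldt n\<close>, plus \<open>ln N\<close> when \<open>n = 1\<close>. After twisting by
  \<open>chi\<close> and swapping, the inner partial sums are themselves small because
  \<open>L1 = 0\<close>, and the remaining sum of \<open>ln (N / d)\<close> is at most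
  \<open>N\<close> by \<open>ln_fact_ge\<close>.\<close>

lemma mangoldt_sum_if_L1_zero:
  assumes "L1 = 0" "N > 0"
  shows "norm (mangoldt_sum N + of_real (ln (real N))) \<le> 2 * B"
proof -
  let ?l = "\<lambda>d. ln (real N / real d)"
  have "mangoldt_sum N + of_real (ln (real N)) =
          (\<Sum>n=1..N. chi n * mangoldt n / of_nat n + (if n = 1 then of_real (ln (real N)) else 0))"
    using \<open>N > 0\<close> by (simp add: char_mangoldt_sum_def sum.distrib)
  also have "\<dots> = (\<Sum>n=1..N. \<Sum>d | d dvd n. chi d * of_real (moebius_mu d * ?l d) / of_nat d *
                     (chi (n div d) / of_nat (n div d)))"
  proof (rule sum.cong[OF refl])
    fix n assume n: "n \<in> {1..N}"
    have "(\<Sum>d | d dvd n. moebius_mu d * ?l d) =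
            (\<Sum>d | d dvd n. moebius_mu d * ln (real N) - moebius_mu d * ln (real d))"
    proof (rule sum.cong[OF refl])
      fix d assume "d \<in> {d. d dvd n}"
      hence "d > 0" using n by (auto intro: Nat.gr0I)
      thus "moebius_mu d * ?l d = moebius_mu d * ln (real N) - moebius_mu d * ln (real d)"
        using \<open>N > 0\<close> by (simp add: ln_div algebra_simps)
    qed
    also have "\<dots> = (if n = 1 then ln (real N) else 0) + mangoldt n"
      using n by (simp add: sum_subtractf sum_distrib_right[symmetric] sum_moebius_mu_divisors
                            mangoldt_eq_sum_moebius_mu_ln)
    finally have "mangoldt n + (if n = 1 then ln (real N) else 0) = (\<Sum>d | d dvd n. moebius_mu d * ?l d)"
      by simp
    hence "complex_of_real (mangoldt n + (if n = 1 then ln (real N) else 0)) =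
             of_real (\<Sum>d | d dvd n. moebius_mu d * ?l d)" by (rule arg_cong)
    hence "chi n * mangoldt n / of_nat n + (if n = 1 then of_real (ln (real N)) else 0) =
            chi n / of_nat n * (\<Sum>d | d dvd n. of_real (moebius_mu d * ?l d))"
      using one by (auto simp: algebra_simps)
    also have "\<dots> = (\<Sum>d | d dvd n. chi n / of_nat n * of_real (moebius_mu d * ?l d))"
      by (rule sum_distrib_left)
    also have "\<dots> = (\<Sum>d | d dvd n. chi d * of_real (moebius_mu d * ?l d) / of_nat d *
                      (chi (n div d) / of_nat (n div d)))"
    proof (rule sum.cong[OF refl])
      fix d assume "d \<in> {d. d dvd n}"
      then obtain k where k: "n = d * k" by auto
      hence "d > 0" using n by (auto intro: Nat.gr0I)
      thus "chi n / of_nat n * of_real (moebius_mu d * ?l d) =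
            chi d * of_real (moebius_mu d * ?l d) / of_nat d * (chi (n div d) / of_nat (n div d))"
        using k by (simp add: mult)
    qed
    finally show "chi n * mangoldt n / of_nat n + (if n = 1 then of_real (ln (real N)) else 0) = \<dots>" .
  qed
  also have "\<dots> = (\<Sum>d=1..N. chi d * of_real (moebius_mu d * ?l d) / of_nat d * harmonic_sum (N div d))"
    by (subst sum_divisors_swap) (simp add: char_harmonic_sum_def sum_distrib_left)
  also have "norm \<dots> \<le> (\<Sum>d=1..N. 1 * (1 * ?l d) / real d * (2 * B * (real d / real N)))"
  proof (intro sum_norm_le)
    fix d assume d: "d \<in> {1..N}"
    have "?l d \<ge> 0" using d by simp
    thus "norm (chi d * of_real (moebius_mu d * ?l d) / of_nat d * harmonic_sum (N div d)) \<le>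
            1 * (1 * ?l d) / real d * (2 * B * (real d / real N))"
      unfolding norm_mult norm_divide norm_of_nat norm_of_real abs_mult
      using harmonic_sum_div_minus_L1[OF d] norm_le[of d] abs_moebius_mu_le[of d] \<open>L1 = 0\<close>
      by (intro mult_mono divide_right_mono) auto
  qed
  also have "\<dots> = 2 * B / real N * (\<Sum>d=1..N. ?l d)"
    by (simp add: sum_distrib_left mult_ac)
  also have "(\<Sum>d=1..N. ?l d) = (\<Sum>d=1..N. ln (real N) - ln (real d))"
    using \<open>N > 0\<close> by (intro sum.cong refl) (simp add: ln_div)
  also have "\<dots> = real N * ln (real N) - ln (fact N)"
    by (simp add: sum_subtractf ln_fact_eq_sum_ln)
  also have "2 * B / real N * \<dots> \<le> 2 * B / real N * real N"
    using B_nonneg ln_fact_ge[of N] by (intro mult_left_mono) auto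
  finally show ?thesis using \<open>N > 0\<close> by simp
qed

text \<open>Both cases in one bound, so that adding over characters counts the vanishing values of
  \<open>L1\<close>.\<close>

lemma Re_mangoldt_sum_le:
  "\<exists>C. \<forall>N>0. Re (mangoldt_sum N) \<le> C - (if L1 = 0 then ln (real N) else 0)"
proof (cases "L1 = 0")
  case True
  have "Re (mangoldt_sum N) \<le> 2 * B - ln (real N)" if "N > 0" for N
    using mangoldt_sum_if_L1_zero[OF True that]
      complex_Re_le_cmod[of "mangoldt_sum N + of_real (ln (real N))"] by simp
  thus ?thesis using True by auto
next
  case False
  obtain C where "\<And>N. norm (mangoldt_sum N) \<le> C"
    using mangoldt_sum_bounded[OF False] by blast
  hence "Re (mangoldt_sum N) \<le> C" for N by (metis complex_Re_le_cmod order.trans)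
  thus ?thesis using False by auto
qed

end

section \<open>Nonvanishing for real characters\<close>

lemma geometric_sum_sign_ge:
  fixes c :: real
  assumes "c \<in> {- 1, 0, 1}"
  shows "(\<Sum>j\<le>k. c ^ j) \<ge> (if even k then 1 else 0)"
proof -
  have "(\<Sum>j\<le>k. (- 1) ^ j) = (if even k then 1 else 0 :: real)" by (induction k) auto
  moreover have "(\<Sum>j\<le>k. 0 ^ j) = (1 :: real)" by (induction k) auto
  ultimately show ?thesis using assms by auto
qed

lemma sum_divisors_completely_mult:
  fixes f :: "nat \<Rightarrow> real"
  assumes mult: "\<And>m n. f (m * n) = f m * f n" and one: "f 1 = 1"
    and q: "prime q" "\<not> q dvd m"
  shows "(\<Sum>d | d dvd q ^ k * m. f d) = (\<Sum>j\<le>k. f q ^ j) * (\<Sum>d | d dvd m. f d)"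
proof -
  have "f (q ^ j) = f q ^ j" for j using one by (induction j) (auto simp: mult)
  thus ?thesis
    unfolding sum_divisors_prime_power_mult[OF q]
    by (simp add: mult sum_distrib_right[symmetric] sum_distrib_left[symmetric])
qed

lemma sum_divisors_sign_nonneg:
  fixes f :: "nat \<Rightarrow> real"
  assumes mult: "\<And>m n. f (m * n) = f m * f n" and one: "f 1 = 1"
    and sign: "\<And>n. f n \<in> {- 1, 0, 1}" and "n > 0"
  shows "(\<Sum>d | d dvd n. f d) \<ge> 0"
  using \<open>n > 0\<close>
proof (induction rule: prime_power_induct)
  case one
  thus ?case using assms(2) by simp
next
  case (mult q k m)
  have "(\<Sum>j\<le>k. f q ^ j) \<ge> 0"
    using geometric_sum_sign_ge[OF sign[of q], of k] by (simp split: if_splits)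
  thus ?case using sum_divisors_completely_mult[of f q m k] assms mult by simp
qed

text \<open>In a square every prime has even exponent, and then each geometric factor is at least 1,
  even where \<open>f q = - 1\<close>.\<close>

lemma sum_divisors_sign_square:
  fixes f :: "nat \<Rightarrow> real"
  assumes mult: "\<And>m n. f (m * n) = f m * f n" and one: "f 1 = 1"
    and sign: "\<And>n. f n \<in> {- 1, 0, 1}" and "n > 0"
  shows "(\<Sum>d | d dvd n\<^sup>2. f d) \<ge> 1"
  using \<open>n > 0\<close>
proof (induction rule: prime_power_induct)
  case one
  thus ?case using assms(2) by simp
next
  case (mult q k m)
  have "(\<Sum>j\<le>2 * k. f q ^ j) \<ge> 1"
    using geometric_sum_sign_ge[OF sign[of q], of "2 * k"] by simp
  moreover have "\<not> q dvd m\<^sup>2" using mult prime_dvd_power by blast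
  moreover have "(q ^ k * m)\<^sup>2 = q ^ (2 * k) * m\<^sup>2"
    by (simp add: power_mult_distrib power_mult[symmetric] mult.commute)
  ultimately show ?case
    using sum_divisors_completely_mult[of f q "m\<^sup>2" "2 * k"] assms mult
      mult_mono[of 1 "\<Sum>j\<le>2 * k. f q ^ j" 1 "\<Sum>d | d dvd m\<^sup>2. f d"] by simp
qed

section \<open>Monsky's monotonicity estimate for Lambert series\<close>

text \<open>The AM-GM inequality for the even powers of \<open>y\<close> up to \<open>2 * n\<close>,
  whose geometric mean is \<open>y ^ n\<close>. The induction by two peels off the first and last
  terms, which together are at least \<open>2 * y ^ n\<close>.\<close>

lemma geometric_sum_ge:
  fixes y :: real
  assumes "0 \<le> y"
  shows "(\<Sum>i<Suc n. (y\<^sup>2) ^ i) \<ge> real (Suc n) * y ^ n"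
proof (induction n rule: induct_nat_012)
  case 1
  have "0 \<le> (y - 1)\<^sup>2" by simp
  thus ?case by (simp add: power2_diff)
next
  case (ge2 n)
  have "(\<Sum>i<Suc (Suc (Suc n)). (y\<^sup>2) ^ i) = 1 + y\<^sup>2 * (\<Sum>i<Suc n. (y\<^sup>2) ^ i) + (y ^ (n + 2))\<^sup>2"
    by (subst sum.lessThan_Suc, subst sum.lessThan_Suc_shift)
       (simp add: sum_distrib_left power_mult_distrib power_add power2_eq_square algebra_simps)
  also have "\<dots> \<ge> 1 + y\<^sup>2 * (real (Suc n) * y ^ n) + (y ^ (n + 2))\<^sup>2"
    using ge2 by (intro add_mono mult_left_mono) auto
  also have "y\<^sup>2 * (real (Suc n) * y ^ n) = real (Suc n) * y ^ (n + 2)"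
    by (simp add: power_add power2_eq_square)
  finally have "1 + real (Suc n) * y ^ (n + 2) + (y ^ (n + 2))\<^sup>2 \<le> (\<Sum>i<Suc (Suc (Suc n)). (y\<^sup>2) ^ i)" .
  moreover have "real (Suc (Suc (Suc n))) * y ^ Suc (Suc n) \<le> 1 + real (Suc n) * y ^ (n + 2) + (y ^ (n + 2))\<^sup>2"
  proof -
    have "0 \<le> (y ^ (n + 2) - 1)\<^sup>2" by simp
    thus ?thesis by (simp add: power2_diff algebra_simps)
  qed
  ultimately show ?case by (rule order.trans[rotated])
qed auto

text \<open>Near \<open>x = 1\<close> the Lambert weight \<open>x ^ n / (1 - x ^ n)\<close>
  resembles \<open>1 / (n * (1 - x))\<close>. Monotonicity of their difference makes Abel summation
  applicable with a bound independent of \<open>x\<close>.\<close>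

lemma lambert_difference_antimono:
  fixes x :: real
  assumes x: "0 < x" "x < 1" and "n > 0"
  defines "b \<equiv> \<lambda>n. 1 / (real n * (1 - x)) - x ^ n / (1 - x ^ n)"
  shows "b (Suc n) \<le> b n"
proof -
  \<comment> \<open>The square root turns powers of \<open>x\<close> into the even powers needed for
    \<open>geometric_sum_ge\<close>.\<close>
  define y where "y = sqrt x"
  have y: "0 < y" "y < 1" "y\<^sup>2 = x" using x by (auto simp: y_def)
  define s where "s = (\<lambda>n. \<Sum>i<n. x ^ i)"
  have s: "1 - x ^ n = (1 - x) * s n" for n
    using one_diff_power_eq[of x n] by (simp add: s_def)
  obtain m where n: "n = Suc m" using \<open>n > 0\<close> by (cases n) auto
  have s_pos: "s n > 0" "s (Suc n) > 0" using x unfolding s_def n by (auto intro!: sum_pos simp del: sum.lessThan_Suc)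
  have "real n * y ^ m * (real (Suc n) * y ^ n) \<le> s n * s (Suc n)"
    using geometric_sum_ge[of y m] geometric_sum_ge[of y n] y s_pos n
    unfolding s_def y(3)[symmetric] by (intro mult_mono) auto
  moreover have "x ^ n \<le> y ^ m * y ^ n"
  proof -
    have "x ^ n = y ^ (m + n + 1)" by (simp add: y(3)[symmetric] power_mult[symmetric] n power_add power2_eq_square power_mult_distrib)
    also have "\<dots> \<le> y ^ (m + n)" using y by (intro power_decreasing) auto
    finally show ?thesis by (simp add: power_add)
  qed
  hence "real n * real (Suc n) * x ^ n \<le> real n * real (Suc n) * (y ^ m * y ^ n)"
    by (intro mult_left_mono) auto
  ultimately have key: "real n * real (Suc n) * x ^ n \<le> s n * s (Suc n)" by (simp add: mult_ac)
  have "b n - b (Suc n) = (1 / (real n * real (Suc n)) - x ^ n / (s n * s (Suc n))) / (1 - x)"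
  proof -
    have 1: "1 / (real n * (1 - x)) - 1 / (real (Suc n) * (1 - x)) = 1 / (real n * real (Suc n)) / (1 - x)"
      using x \<open>n > 0\<close> by (simp add: divide_simps)
    have "x ^ n * s (Suc n) - x * x ^ n * s n = x ^ n"
    proof -
      have "s (Suc n) = 1 + x * s n"
        by (simp only: s_def sum.lessThan_Suc_shift) (simp add: sum_distrib_left)
      thus ?thesis by (simp add: algebra_simps)
    qed
    hence 2: "x ^ n / (1 - x ^ n) - x ^ Suc n / (1 - x ^ Suc n) = x ^ n / (s n * s (Suc n)) / (1 - x)"
      unfolding s using x s_pos by (simp add: divide_simps)
    show ?thesis unfolding b_def diff_divide_distrib 1[symmetric] 2[symmetric] by simp
  qed
  also have "\<dots> \<ge> 0"
    using x key s_pos \<open>n > 0\<close> by (intro divide_nonneg_nonneg) (auto simp: divide_simps mult_ac)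
  finally show ?thesis by simp
qed

lemma lambert_difference_nonneg:
  fixes x :: real
  assumes x: "0 < x" "x < 1" and "n > 0"
  shows "1 / (real n * (1 - x)) - x ^ n / (1 - x ^ n) \<ge> 0"
proof -
  have "real n * x ^ n = (\<Sum>i<n. x ^ n)" by simp
  also have "\<dots> \<le> (\<Sum>i<n. x ^ i)" using x by (intro sum_mono power_decreasing) auto
  finally have "real n * x ^ n * (1 - x) \<le> 1 - x ^ n"
    using one_diff_power_eq[of x n] x by (simp add: mult.commute mult_left_mono)
  moreover have "x ^ n < 1" using x \<open>n > 0\<close> by (simp add: power_less_one_iff)
  ultimately show ?thesis using x \<open>n > 0\<close> by (simp add: divide_simps mult_ac)
qed

context bounded_character
begin

text \<open>The power series with coefficients \<open>A n\<close> is rearranged as a Lambert series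
  in \<open>r d\<close>. Subtracting \<open>b d\<close> from \<open>1 / (d * (1 - x))\<close>
  recovers each Lambert weight: the first part sums to \<open>L1 / (1 - x) = 0\<close> in the limit,
  the second is bounded by partial summation. Everything is done with a cutoff \<open>N\<close> that
  is finally sent to infinity.\<close>

lemma real_L1_zero_bound:
  assumes sign: "\<And>n. chi n \<in> {- 1, 0, 1}" and L0: "L1 = 0" and x: "0 < x" "x < 1"
  shows "(\<Sum>m=1..M. x ^ m\<^sup>2) \<le> 2 * B"
proof -
  define r where "r = (\<lambda>n. Re (chi n))"
  have chi: "chi n = of_real (r n)" for n using sign[of n] by (auto simp: r_def complex_eq_iff)
  have r: "r (m * n) = r m * r n" "r 1 = 1" "r n \<in> {- 1, 0, 1}" for m n
  proof -
    have "complex_of_real (r (m * n)) = of_real (r m * r n)"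
      unfolding of_real_mult chi[symmetric] by (rule mult)
    thus "r (m * n) = r m * r n" by (simp only: of_real_eq_iff)
    show "r 1 = 1" "r n \<in> {- 1, 0, 1}" using one sign[of n] by (auto simp: r_def)
  qed
  have r_abs: "\<bar>r n\<bar> \<le> 1" for n using r(3)[of n] by auto
  define A where "A = (\<lambda>n. \<Sum>d | d dvd n. r d)"
  define b where "b = (\<lambda>n. 1 / (real n * (1 - x)) - x ^ n / (1 - x ^ n))"
  \<comment> \<open>The first summand comes from truncating the series for \<open>L1\<close>, the
    second from truncating \<open>N\<close> geometric series.\<close>
  define err where "err = (\<lambda>N. 2 * B / real (N + 1) / (1 - x) + real N * x ^ N / (1 - x))"
  have bound: "(\<Sum>m=1..M. x ^ m\<^sup>2) \<le> 2 * B + err N" if N: "N \<ge> M\<^sup>2" for N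
  proof -
    have "(\<Sum>m=1..M. x ^ m\<^sup>2) = (\<Sum>n\<in>power2 ` {1..M}. x ^ n)"
      by (subst sum.reindex) (auto intro!: inj_onI)
    also have "\<dots> \<le> (\<Sum>n\<in>power2 ` {1..M}. A n * x ^ n)"
    proof (intro sum_mono)
      fix n assume "n \<in> power2 ` {1..M}"
      hence "A n \<ge> 1" unfolding A_def by (auto intro!: sum_divisors_sign_square[OF r])
      thus "x ^ n \<le> A n * x ^ n" using x by simp
    qed
    also have "\<dots> \<le> (\<Sum>n=1..N. A n * x ^ n)"
    proof (intro sum_mono2)
      show "power2 ` {1..M} \<subseteq> {1..N}"
      proof clarify
        fix m assume "m \<in> {1..M}"
        hence "1 \<le> m\<^sup>2" "m\<^sup>2 \<le> M\<^sup>2" by (auto intro: power_mono)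
        thus "m\<^sup>2 \<in> {1..N}" using N unfolding atLeastAtMost_iff by linarith
      qed
      show "0 \<le> A n * x ^ n" if "n \<in> {1..N} - power2 ` {1..M}" for n
        using that x unfolding A_def by (intro mult_nonneg_nonneg sum_divisors_sign_nonneg[OF r]) auto
    qed auto
    also have "\<dots> = (\<Sum>n=1..N. \<Sum>d | d dvd n. r d * x ^ (d * (n div d)))"
      unfolding A_def sum_distrib_right by (intro sum.cong refl) auto
    also have "\<dots> = (\<Sum>d=1..N. r d * (\<Sum>m=1..N div d. (x ^ d) ^ m))"
      by (subst sum_divisors_swap) (simp add: sum_distrib_left power_mult)
    also have "\<dots> \<le> (\<Sum>d=1..N. r d * (x ^ d / (1 - x ^ d)) + x ^ N / (1 - x))"
    proof (intro sum_mono)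
      fix d assume d: "d \<in> {1..N}"
      define K where "K = N div d"
      have xd: "x ^ d \<le> x" using x d power_decreasing[of 1 d x] by simp
      have "(\<Sum>m=1..K. (x ^ d) ^ m) = (x ^ d - (x ^ d) ^ Suc K) / (1 - x ^ d)"
        using sum_gp[of "x ^ d" 1 K] xd x by auto
      hence "r d * (\<Sum>m=1..K. (x ^ d) ^ m) =
               r d * (x ^ d / (1 - x ^ d)) + (- r d) * ((x ^ d) ^ Suc K / (1 - x ^ d))"
        by (simp only: diff_divide_distrib) (simp add: algebra_simps)
      also have "(- r d) * ((x ^ d) ^ Suc K / (1 - x ^ d)) \<le> 1 * (x ^ N / (1 - x))"
      proof (rule mult_mono)
        \<comment> \<open>The first omitted exponent is at least \<open>N\<close>, so the tail of
          each geometric series is at most \<open>x ^ N / (1 - x)\<close>, uniformly in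
          \<open>d\<close>.\<close>
        have "N \<le> d * Suc K"
          unfolding K_def using d dividend_less_times_div[of d N] by simp
        hence "(x ^ d) ^ Suc K \<le> x ^ N"
          unfolding power_mult[symmetric] using x by (intro power_decreasing) auto
        thus "(x ^ d) ^ Suc K / (1 - x ^ d) \<le> x ^ N / (1 - x)"
          using x xd by (intro frac_le) auto
      qed (use r_abs[of d] x xd in auto)
      finally show "r d * (\<Sum>m=1..N div d. (x ^ d) ^ m) \<le> r d * (x ^ d / (1 - x ^ d)) + x ^ N / (1 - x)"
        by (simp add: K_def)
    qed
    also have "\<dots> = (\<Sum>d=1..N. r d * (1 / (real d * (1 - x)) - b d)) + real N * x ^ N / (1 - x)"
      by (simp add: sum.distrib b_def)
    also have "(\<Sum>d=1..N. r d * (1 / (real d * (1 - x)) - b d)) =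
                 (\<Sum>d=1..N. r d / real d) / (1 - x) - (\<Sum>d=1..N. r d * b d)"
      by (simp add: right_diff_distrib sum_subtractf sum_divide_distrib)
    also have "\<dots> \<le> 2 * B / real (N + 1) / (1 - x) + 2 * B"
    proof -
      have "harmonic_sum N = of_real (\<Sum>d=1..N. r d / real d)"
        by (simp add: char_harmonic_sum_def chi)
      hence "\<bar>\<Sum>d=1..N. r d / real d\<bar> \<le> 2 * B / real (N + 1)"
        using harmonic_sum_minus_L1[of N] L0 by (simp only: diff_zero norm_of_real)
      hence 1: "(\<Sum>d=1..N. r d / real d) / (1 - x) \<le> 2 * B / real (N + 1) / (1 - x)"
        using x by (intro divide_right_mono) auto
      have "norm (\<Sum>n\<in>{0<..N}. chi n * of_real (b n)) \<le> 2 * B * b (Suc 0)"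
        by (rule norm_sum_mult_antimono_le[OF norm_sum_le])
           (use lambert_difference_nonneg[OF x] lambert_difference_antimono[OF x] in \<open>auto simp: b_def\<close>)
      moreover have "b (Suc 0) = 1" using x by (simp add: b_def divide_simps)
      moreover have "(\<Sum>n\<in>{0<..N}. chi n * of_real (b n)) = of_real (\<Sum>d=1..N. r d * b d)"
        by (simp add: chi atLeastSucAtMost_greaterThanAtMost)
      ultimately have "\<bar>\<Sum>d=1..N. r d * b d\<bar> \<le> 2 * B" by (simp only: norm_of_real mult_1_right)
      with 1 show ?thesis by linarith
    qed
    finally show ?thesis by (simp add: err_def)
  qed
  have "(\<lambda>N. 2 * B + err N) \<longlonglongrightarrow> 2 * B + (0 / (1 - x) + 0 / (1 - x))"
    unfolding err_def using x powser_times_n_limit_0[of x]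
    by (intro tendsto_intros tail_tendsto_0) auto
  thus ?thesis
    using bound by (intro LIMSEQ_le_const[of "\<lambda>N. 2 * B + err N"]) auto
qed

lemma real_L1_nonzero:
  assumes sign: "\<And>n. chi n \<in> {- 1, 0, 1}"
  shows "L1 \<noteq> 0"
proof
  assume L0: "L1 = 0"
  obtain M where M: "real M > 2 * B" using reals_Archimedean2 by blast
  \<comment> \<open>For fixed \<open>M\<close> this is a polynomial with value \<open>M\<close> at
    1, so the bound uniform in \<open>x\<close> passes to the limit.\<close>
  have "((\<lambda>x. \<Sum>m=1..M. x ^ m\<^sup>2) \<longlongrightarrow> (\<Sum>m=1..M. 1 ^ m\<^sup>2)) (at_left (1 :: real))"
    by (intro tendsto_intros)
  moreover have "eventually (\<lambda>x :: real. (\<Sum>m=1..M. x ^ m\<^sup>2) \<le> 2 * B) (at_left 1)"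
    unfolding eventually_at_left_field
    using real_L1_zero_bound[OF sign L0] by (intro exI[of _ 0]) auto
  ultimately have "(\<Sum>m=1..M. 1 ^ m\<^sup>2) \<le> 2 * B"
    by (intro tendsto_upperbound) auto
  thus False using M by simp
qed

end

section \<open>Dirichlet's theorem for prime moduli\<close>

locale odd_prime_primroot =
  fixes p g :: nat
  assumes p: "prime p" "p > 2" and g: "residue_primroot p g"
begin

text \<open>The range condition makes the exponent unique when \<open>p\<close> does not divide
  \<open>n\<close>. For multiples of \<open>p\<close> no exponent exists and the value is arbitrary,
  so \<open>chr\<close> treats them separately.\<close>

definition dlog :: "nat \<Rightarrow> nat" where
  "dlog n = (SOME i. i < p - 1 \<and> [g ^ i = n] (mod p))"

definition zeta :: complex where "zeta = cis (2 * pi / real (p - 1))"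

text \<open>The Dirichlet character modulo \<open>p\<close> sending \<open>g\<close> to
  \<open>zeta ^ j\<close>; \<open>j = 0\<close> gives the principal one, and
  \<open>j < p - 1\<close> gives each character once.\<close>

definition chr :: "nat \<Rightarrow> nat \<Rightarrow> complex" where
  "chr j n = (if p dvd n then 0 else zeta ^ (j * dlog n))"

lemma dlog:
  assumes "\<not> p dvd n"
  shows "dlog n < p - 1" and "[g ^ dlog n = n] (mod p)"
proof -
  have "n mod p \<in> totatives p"
    using p assms by (auto simp: totatives_prime dvd_eq_mod_eq_0 intro: Nat.gr0I)
  then obtain i where i: "i < p - 1" "n mod p = g ^ i mod p"
    using bij_betw_imp_surj_on[OF residue_primroot_is_generator[OF _ g]] p
    by (auto simp: totient_prime)
  hence "\<exists>i. i < p - 1 \<and> [g ^ i = n] (mod p)" by (auto simp: cong_def)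
  from someI_ex[OF this] show "dlog n < p - 1" "[g ^ dlog n = n] (mod p)"
    by (auto simp: dlog_def)
qed

lemma coprime_p_g: "coprime p g" and ord_g: "ord p g = p - 1"
  using g p by (auto simp: residue_primroot_def totient_prime)

lemma dlog_cong_iff:
  assumes "\<not> p dvd m" "\<not> p dvd n"
  shows "dlog m = dlog n \<longleftrightarrow> [m = n] (mod p)"
proof
  assume "dlog m = dlog n"
  thus "[m = n] (mod p)" using dlog(2)[OF assms(1)] dlog(2)[OF assms(2)] by (metis cong_sym cong_trans)
next
  assume "[m = n] (mod p)"
  hence "[g ^ dlog m = g ^ dlog n] (mod p)"
    using dlog(2)[OF assms(1)] dlog(2)[OF assms(2)] by (metis cong_sym cong_trans)
  hence "[dlog m = dlog n] (mod p - 1)"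
    using order_divides_expdiff[OF coprime_p_g] by (simp add: ord_g)
  thus "dlog m = dlog n"
    using dlog(1)[OF assms(1)] dlog(1)[OF assms(2)] by (simp add: cong_def)
qed

lemma dlog_mult:
  assumes "\<not> p dvd m" "\<not> p dvd n"
  shows "[dlog (m * n) = dlog m + dlog n] (mod p - 1)"
proof -
  have "\<not> p dvd m * n" using assms p by (simp add: prime_dvd_mult_iff)
  hence "[g ^ dlog (m * n) = m * n] (mod p)" by (rule dlog)
  also have "[m * n = g ^ dlog m * g ^ dlog n] (mod p)"
    using assms by (intro cong_mult cong_sym[OF dlog(2)])
  finally show ?thesis
    unfolding power_add[symmetric] using order_divides_expdiff[OF coprime_p_g] by (simp add: ord_g)
qed

lemma dlog_cong:
  assumes "[m = n] (mod p)"
  shows "dlog m = dlog n"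
  using assms unfolding dlog_def by (metis cong_sym cong_trans)

lemma dlog_generator_power:
  assumes "i < p - 1"
  shows "dlog (g ^ i mod p) = i" and "\<not> p dvd g ^ i mod p"
proof -
  have "coprime p (g ^ i)" using coprime_p_g by simp
  hence *: "\<not> p dvd g ^ i" using p by (metis coprime_absorb_left not_prime_unit)
  thus "\<not> p dvd g ^ i mod p" by (simp add: dvd_mod_iff)
  have "[g ^ dlog (g ^ i) = g ^ i] (mod p)" by (rule dlog[OF *])
  hence "[dlog (g ^ i) = i] (mod p - 1)"
    using order_divides_expdiff[OF coprime_p_g] by (simp add: ord_g)
  hence "dlog (g ^ i) = i" using assms dlog(1)[OF *] by (simp add: cong_def)
  thus "dlog (g ^ i mod p) = i" using dlog_cong[of "g ^ i mod p" "g ^ i"] by (simp add: cong_def)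
qed

lemma zeta_power: "zeta ^ k = cis (2 * pi * real k / real (p - 1))"
  by (simp add: zeta_def DeMoivre mult_ac)

lemma zeta_power_order: "zeta ^ (p - 1) = 1"
  using p by (simp add: zeta_power)

lemma zeta_power_inj: "zeta ^ i = zeta ^ j \<longleftrightarrow> i = j" if "i < p - 1" "j < p - 1"
  using bij_betw_imp_inj_on[OF bij_betw_roots_unity[of "p - 1"]] that p
  by (auto simp: zeta_power inj_on_def)

lemma norm_zeta: "norm zeta = 1"
  by (simp add: zeta_def)

lemma cnj_zeta_power_mult: "cnj (zeta ^ k) * zeta ^ k = 1"
  using complex_norm_square[of "zeta ^ k"] by (simp add: norm_power norm_zeta mult.commute)

lemma chr_1: "chr j 1 = 1"
proof -
  have p1: "\<not> p dvd 1" using p by auto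
  have "dlog 1 = 0" using dlog_generator_power(1)[of 0] p by simp
  thus ?thesis using p1 by (simp add: chr_def)
qed

lemma chr_mult: "chr j (m * n) = chr j m * chr j n"
proof (cases "p dvd m \<or> p dvd n")
  case True
  thus ?thesis by (auto simp: chr_def)
next
  case False
  have "zeta ^ (dlog (m * n) * j) = zeta ^ ((dlog m + dlog n) * j)"
    by (rule power_eq_power_if_cong[OF zeta_power_order])
       (use False in \<open>intro cong_mult dlog_mult cong_refl; simp\<close>)
  thus ?thesis using False p
    by (simp add: chr_def prime_dvd_mult_iff power_add[symmetric] algebra_simps)
qed

lemma norm_chr_le: "norm (chr j n) \<le> 1"
  by (simp add: chr_def norm_power norm_zeta)

lemma chr_0: "chr 0 n = (if p dvd n then 0 else 1)"
  by (simp add: chr_def)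

text \<open>Listing the residues as powers of \<open>g\<close> gives a geometric sum of the
  nontrivial root of unity \<open>zeta ^ j\<close>.\<close>

lemma sum_chr_period:
  assumes "0 < j" "j < p - 1"
  shows "(\<Sum>n=1..p. chr j n) = 0"
proof -
  have "(\<Sum>n=1..p. chr j n) = (\<Sum>n\<in>totatives p. chr j n)"
    using p by (intro sum.mono_neutral_right) (auto simp: totatives_prime chr_def)
  also have "\<dots> = (\<Sum>i<p - 1. chr j (g ^ i mod p))"
    using sum.reindex_bij_betw[OF residue_primroot_is_generator[OF _ g], of "chr j"] p
    by (simp add: totient_prime)
  also have "\<dots> = (\<Sum>i<p - 1. (zeta ^ j) ^ i)"
    by (intro sum.cong refl) (simp add: chr_def dlog_generator_power power_mult)
  also have "(zeta ^ j) ^ (p - 1) = 1"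
    by (metis mult.commute power_mult power_one zeta_power_order)
  hence "(\<Sum>i<p - 1. (zeta ^ j) ^ i) = (if zeta ^ j = 1 then of_nat (p - 1) else 0)"
    by (rule sum_powers_root_of_unity)
  finally show ?thesis using zeta_power_inj[of j 0] assms by simp
qed

lemma bounded_character_chr:
  assumes "j \<in> {0<..<p - 1}"
  shows "bounded_character (chr j) (real p)"
proof
  show "norm (\<Sum>n=1..N. chr j n) \<le> real p" for N
  proof (rule norm_sum_periodic_le)
    show "chr j (n + p) = chr j n" for n
      using dlog_cong[of "n + p" n] by (simp add: chr_def cong_def)
    show "(\<Sum>n=1..p. chr j n) = 0" using assms sum_chr_period by auto
  qed (use p norm_chr_le in auto)
qed (auto simp: chr_1[simplified] chr_mult norm_chr_le)

text \<open>As a function of \<open>j\<close> the summand is \<open>w ^ j\<close> for a root of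
  unity \<open>w\<close>, which equals 1 exactly when the discrete logarithms of \<open>n\<close>
  and \<open>a\<close> agree.\<close>

lemma chr_orthogonality:
  assumes "\<not> p dvd a"
  shows "(\<Sum>j<p - 1. cnj (chr j a) * chr j n) = (if [n = a] (mod p) then of_nat (p - 1) else 0)"
proof (cases "p dvd n")
  case True
  hence "\<not> [n = a] (mod p)" using assms cong_dvd_iff by blast
  thus ?thesis using True by (simp add: chr_def)
next
  case False
  define w where "w = cnj (zeta ^ dlog a) * zeta ^ dlog n"
  have "w ^ (p - 1) = cnj ((zeta ^ (p - 1)) ^ dlog a) * (zeta ^ (p - 1)) ^ dlog n"
    by (simp add: w_def power_mult_distrib power_mult[symmetric] mult.commute)
  hence "w ^ (p - 1) = 1" by (simp only: zeta_power_order power_one complex_cnj_one mult_1)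
  hence "(\<Sum>j<p - 1. w ^ j) = (if w = 1 then of_nat (p - 1) else 0)"
    by (rule sum_powers_root_of_unity)
  moreover have "cnj (chr j a) * chr j n = w ^ j" for j
    using False assms
    by (simp add: chr_def w_def power_mult_distrib power_mult[symmetric] mult.commute)
  moreover have "w = 1 \<longleftrightarrow> [n = a] (mod p)"
  proof -
    have "w = 1 \<longleftrightarrow> zeta ^ dlog n = zeta ^ dlog a"
    proof
      assume "w = 1"
      hence "zeta ^ dlog a * w = zeta ^ dlog a" by simp
      moreover have "zeta ^ dlog a * w = (cnj (zeta ^ dlog a) * zeta ^ dlog a) * zeta ^ dlog n"
        by (simp add: w_def mult_ac)
      ultimately show "zeta ^ dlog n = zeta ^ dlog a" by (simp only: cnj_zeta_power_mult mult_1)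
    qed (simp only: w_def cnj_zeta_power_mult)
    also have "\<dots> \<longleftrightarrow> dlog n = dlog a" using False assms by (intro zeta_power_inj dlog)
    also have "\<dots> \<longleftrightarrow> [n = a] (mod p)" using False assms by (rule dlog_cong_iff)
    finally show ?thesis .
  qed
  ultimately show ?thesis by simp
qed

lemma cnj_chr:
  assumes "j < p - 1"
  shows "cnj (chr j n) = chr (p - 1 - j) n"
proof (cases "p dvd n")
  case False
  have "zeta ^ (j * dlog n) * zeta ^ ((p - 1 - j) * dlog n) = (zeta ^ (p - 1)) ^ dlog n"
    using assms by (simp add: power_add[symmetric] add_mult_distrib[symmetric] power_mult[symmetric])
  hence *: "zeta ^ (j * dlog n) * zeta ^ ((p - 1 - j) * dlog n) = 1"
    by (simp only: zeta_power_order power_one)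
  have "cnj (zeta ^ (j * dlog n)) =
          cnj (zeta ^ (j * dlog n)) * (zeta ^ (j * dlog n) * zeta ^ ((p - 1 - j) * dlog n))"
    by (simp only: * mult_1_right)
  also have "\<dots> = zeta ^ ((p - 1 - j) * dlog n)"
    by (simp only: mult.assoc[symmetric] cnj_zeta_power_mult mult_1)
  finally have "cnj (zeta ^ (j * dlog n)) = zeta ^ ((p - 1 - j) * dlog n)" .
  thus ?thesis using False by (simp add: chr_def)
qed (simp add: chr_def)

lemma chr_real:
  assumes "2 * j = p - 1"
  shows "chr j n \<in> {- 1, 0, 1}"
proof (cases "p dvd n")
  case False
  have "(zeta ^ (j * dlog n))\<^sup>2 = (zeta ^ (p - 1)) ^ dlog n"
    unfolding assms[symmetric] by (simp add: power_mult[symmetric] mult_ac)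
  hence "(zeta ^ (j * dlog n))\<^sup>2 = 1" by (simp only: zeta_power_order power_one)
  thus ?thesis using False by (auto simp: chr_def power2_eq_1_iff)
qed (simp add: chr_def)

lemma sum_cnj_chr_mangoldt_sum:
  assumes "\<not> p dvd a"
  shows "(\<Sum>j<p - 1. cnj (chr j a) * char_mangoldt_sum (chr j) N) =
           of_real (real (p - 1) * (\<Sum>n | n \<in> {1..N} \<and> [n = a] (mod p). mangoldt n / real n))"
proof -
  have "(\<Sum>j<p - 1. cnj (chr j a) * char_mangoldt_sum (chr j) N) =
          (\<Sum>j<p - 1. \<Sum>n=1..N. (cnj (chr j a) * chr j n) * (mangoldt n / of_nat n))"
    by (simp add: char_mangoldt_sum_def sum_distrib_left mult_ac)
  also have "\<dots> = (\<Sum>n=1..N. (\<Sum>j<p - 1. cnj (chr j a) * chr j n) * (mangoldt n / of_nat n))"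
    by (subst sum.swap) (simp only: sum_distrib_right)
  also have "\<dots> = (\<Sum>n=1..N. if [n = a] (mod p) then of_real (real (p - 1) * (mangoldt n / real n)) else 0)"
    unfolding chr_orthogonality[OF assms] by (intro sum.cong refl) auto
  also have "\<dots> = (\<Sum>n | n \<in> {1..N} \<and> [n = a] (mod p). of_real (real (p - 1) * (mangoldt n / real n)))"
    by (rule sum.inter_filter[symmetric]) simp
  finally show ?thesis by (simp add: sum_distrib_left)
qed

lemma principal_mangoldt_sum:
  "char_mangoldt_sum (chr 0) N = of_real (\<Sum>n | n \<in> {1..N} \<and> \<not> p dvd n. mangoldt n / real n)"
proof -
  have "char_mangoldt_sum (chr 0) N = (\<Sum>n=1..N. if \<not> p dvd n then of_real (mangoldt n / real n) else 0)"
    unfolding char_mangoldt_sum_def chr_0 by (intro sum.cong) auto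
  also have "\<dots> = (\<Sum>n | n \<in> {1..N} \<and> \<not> p dvd n. of_real (mangoldt n / real n))"
    by (rule sum.inter_filter[symmetric]) simp
  finally show ?thesis by simp
qed

lemma L_one_cnj_chr:
  assumes "j \<in> {0<..<p - 1}"
  shows "L_one (chr (p - 1 - j)) = cnj (L_one (chr j))"
proof -
  have "char_harmonic_sum (chr (p - 1 - j)) = (\<lambda>N. cnj (char_harmonic_sum (chr j) N))"
    using assms by (simp add: fun_eq_iff char_harmonic_sum_def cnj_chr)
  moreover have "(\<lambda>N. cnj (char_harmonic_sum (chr j) N)) \<longlonglongrightarrow> cnj (L_one (chr j))"
    by (intro tendsto_cnj bounded_character.harmonic_sum_tendsto[OF bounded_character_chr] assms)
  ultimately show ?thesis unfolding L_one_def[of "chr (p - 1 - j)"] by (simp add: limI)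
qed

text \<open>Two vanishing values \<open>L(1, \<chi>)\<close> would make the weighted count of prime powers congruent to 1
  drift to \<open>-\<infinity>\<close>, although it is nonnegative; so a vanishing character is its own conjugate.\<close>

lemma L_one_chr_nonzero:
  assumes j: "j \<in> {0<..<p - 1}"
  shows "L_one (chr j) \<noteq> 0"
proof (cases "2 * j = p - 1")
  case True
  show ?thesis
    by (rule bounded_character.real_L1_nonzero[OF bounded_character_chr[OF j] chr_real[OF True]])
next
  case False
  show ?thesis
  proof
    assume L0: "L_one (chr j) = 0"
    define k where "k = p - 1 - j"
    have k: "k \<in> {0<..<p - 1}" "k \<noteq> j" "L_one (chr k) = 0"
      using j False L_one_cnj_chr[OF j] L0 by (auto simp: k_def)
    let ?I = "{0<..<p - 1}"
    let ?z = "\<lambda>i N. if L_one (chr i) = 0 then ln (real N) else 0"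
    obtain C where C: "\<And>i N. i \<in> ?I \<Longrightarrow> N > 0 \<Longrightarrow> Re (char_mangoldt_sum (chr i) N) \<le> C i - ?z i N"
      using bounded_character.Re_mangoldt_sum_le[OF bounded_character_chr] by metis
    have I: "{..<p - 1} = insert 0 ?I" using p by auto
    have "ln (real N) \<le> 4 + (\<Sum>i\<in>?I. C i)" if N: "N > 0" for N
    proof -
      have p1: "\<not> p dvd 1" using p by auto
      have "0 \<le> real (p - 1) * (\<Sum>n | n \<in> {1..N} \<and> [n = 1] (mod p). mangoldt n / real n)"
        by (intro mult_nonneg_nonneg sum_nonneg divide_nonneg_nonneg mangoldt_nonneg) auto
      also have "\<dots> = Re (\<Sum>i<p - 1. cnj (chr i 1) * char_mangoldt_sum (chr i) N)"
        by (subst sum_cnj_chr_mangoldt_sum[OF p1]) (simp only: Re_complex_of_real)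
      also have "\<dots> = (\<Sum>i<p - 1. Re (char_mangoldt_sum (chr i) N))"
        unfolding chr_1 by simp
      also have "\<dots> = Re (char_mangoldt_sum (chr 0) N) + (\<Sum>i\<in>?I. Re (char_mangoldt_sum (chr i) N))"
        unfolding I by (subst sum.insert) auto
      also have "Re (char_mangoldt_sum (chr 0) N) \<le> (\<Sum>n=1..N. mangoldt n / real n)"
        unfolding principal_mangoldt_sum Re_complex_of_real
        by (intro sum_mono2) (auto simp: mangoldt_nonneg)
      also have "\<dots> \<le> ln (real N) + 4" by (rule sum_mangoldt_over_le[OF N])
      also have "(\<Sum>i\<in>?I. Re (char_mangoldt_sum (chr i) N)) \<le> (\<Sum>i\<in>?I. C i - ?z i N)"
        using C N by (intro sum_mono) auto
      also have "\<dots> = (\<Sum>i\<in>?I. C i) - (\<Sum>i\<in>?I. ?z i N)" by (rule sum_subtractf)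
      \<comment> \<open>The indices \<open>j\<close> and \<open>k\<close> alone cost
        \<open>2 * ln N\<close>, more than the \<open>ln N + 4\<close> gained from the principal
        character.\<close>
      also have "(\<Sum>i\<in>?I. ?z i N) \<ge> (\<Sum>i\<in>{j, k}. ?z i N)"
        using j k N by (intro sum_mono2) auto
      hence "(\<Sum>i\<in>?I. C i) - (\<Sum>i\<in>?I. ?z i N) \<le> (\<Sum>i\<in>?I. C i) - 2 * ln (real N)"
        using k L0 by simp
      finally show ?thesis by simp
    qed
    thus False using ln_real_of_nat_unbounded by (meson not_le)
  qed
qed

text \<open>If there were only finitely many such primes, the weights \<open>mangoldt n / n\<close>
  over \<open>n\<close> congruent to \<open>a\<close> would stay bounded. By orthogonality and the
  bounded non-principal sums, the principal sum would then be bounded too, contradicting its growth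
  like \<open>ln N\<close>.\<close>

theorem infinite_primes_cong:
  assumes a: "\<not> p dvd a"
  shows "infinite {q. prime q \<and> [q = a] (mod p)}" (is "infinite ?P")
proof
  assume fin: "finite ?P"
  let ?I = "{0<..<p - 1}"
  have I: "{..<p - 1} = insert 0 ?I" using p by auto
  obtain K where K: "\<And>N. (\<Sum>n | n \<in> {1..N} \<and> \<not> prime n. mangoldt n / real n) \<le> K"
    using sum_mangoldt_over_nonprime_bounded by blast
  have "\<exists>C. \<forall>N. norm (char_mangoldt_sum (chr i) N) \<le> C" if i: "i \<in> ?I" for i
    using bounded_character.mangoldt_sum_bounded[OF bounded_character_chr[OF i] L_one_chr_nonzero[OF i]] .
  then obtain C where C: "\<And>i N. i \<in> ?I \<Longrightarrow> norm (char_mangoldt_sum (chr i) N) \<le> C i" by metis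
  \<comment> \<open>Applied with \<open>F = {p}\<close> to the multiples of \<open>p\<close>, and
    with the supposedly finite set of primes to the residue class of \<open>a\<close>.\<close>
  have le: "(\<Sum>n\<in>A. mangoldt n / real n) \<le> (\<Sum>n\<in>F. mangoldt n / real n) + K"
    if "A \<subseteq> F \<union> {n. n \<in> {1..N} \<and> \<not> prime n}" "finite F" for A F N
  proof -
    have "(\<Sum>n\<in>A. mangoldt n / real n) \<le> (\<Sum>n\<in>F \<union> {n. n \<in> {1..N} \<and> \<not> prime n}. mangoldt n / real n)"
      using that by (intro sum_mono2) (auto simp: mangoldt_nonneg)
    also have "\<dots> \<le> (\<Sum>n\<in>F. mangoldt n / real n) + (\<Sum>n | n \<in> {1..N} \<and> \<not> prime n. mangoldt n / real n)"
      using that by (subst sum_Un) (auto simp: mangoldt_nonneg intro!: sum_nonneg)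
    finally show ?thesis using K[of N] by linarith
  qed
  define D where "D = real (p - 1) * ((\<Sum>n\<in>?P. mangoldt n / real n) + K) + (\<Sum>i\<in>?I. C i)
                        + mangoldt p / real p + K + 1"
  have "ln (real N) \<le> D" if N: "N > 0" for N
  proof -
    have "ln (real N) - 1 \<le> (\<Sum>n=1..N. mangoldt n / real n)" by (rule sum_mangoldt_over_ge[OF N])
    also have "{1..N} = {n. n \<in> {1..N} \<and> \<not> p dvd n} \<union> {n. n \<in> {1..N} \<and> p dvd n}" by auto
    also have "(\<Sum>n\<in>\<dots>. mangoldt n / real n) =
                 (\<Sum>n | n \<in> {1..N} \<and> \<not> p dvd n. mangoldt n / real n) +
                 (\<Sum>n | n \<in> {1..N} \<and> p dvd n. mangoldt n / real n)"
      by (rule sum.union_disjoint) auto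
    also have "(\<Sum>n | n \<in> {1..N} \<and> p dvd n. mangoldt n / real n) \<le> (\<Sum>n\<in>{p}. mangoldt n / real n) + K"
      using p by (intro le[of _ _ N]) (auto dest: primes_dvd_imp_eq)
    finally have 1: "ln (real N) \<le> Re (char_mangoldt_sum (chr 0) N) + mangoldt p / real p + K + 1"
      unfolding principal_mangoldt_sum Re_complex_of_real by simp
    let ?s = "\<Sum>i\<in>?I. cnj (chr i a) * char_mangoldt_sum (chr i) N"
    have "norm ?s \<le> (\<Sum>i\<in>?I. 1 * C i)"
    proof (intro sum_norm_le)
      fix i assume "i \<in> ?I"
      thus "norm (cnj (chr i a) * char_mangoldt_sum (chr i) N) \<le> 1 * C i"
        unfolding norm_mult complex_mod_cnj using norm_chr_le C by (intro mult_mono) auto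
    qed
    hence 2: "- Re ?s \<le> (\<Sum>i\<in>?I. C i)" using abs_Re_le_cmod[of ?s] by simp
    have "Re (char_mangoldt_sum (chr 0) N) + Re ?s =
                     Re (\<Sum>i<p - 1. cnj (chr i a) * char_mangoldt_sum (chr i) N)"
      using a unfolding I by (subst sum.insert) (auto simp: chr_0)
    also have "\<dots> = real (p - 1) * (\<Sum>n | n \<in> {1..N} \<and> [n = a] (mod p). mangoldt n / real n)"
      by (subst sum_cnj_chr_mangoldt_sum[OF a]) (simp only: Re_complex_of_real)
    also have "\<dots> \<le> real (p - 1) * ((\<Sum>n\<in>?P. mangoldt n / real n) + K)"
      using fin by (intro mult_left_mono le[of _ _ N]) auto
    finally show ?thesis using 1 2 unfolding D_def by linarith
  qed
  thus False using ln_real_of_nat_unbounded by (meson not_le)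
qed

end

section \<open>Primes congruent to half of p - 1\<close>

theorem theorem3:
  fixes p :: nat
  assumes "prime p" and "odd p"
  shows "\<exists>S :: nat set. infinite S \<and>
           (\<forall>q\<in>S. prime q \<and> 2 * q \<notin> totient ` {n. 0 < n} \<and> p dvd 2 * q + 1)"
proof -
  obtain g where g: "residue_primroot p g"
    using prime_primitive_root_exists[of p] assms prime_gt_1_nat by blast
  have p2: "p > 2" using assms prime_ge_2_nat[of p] by (cases "p = 2") auto
  have primroot: "odd_prime_primroot p g" using assms p2 g by (simp add: odd_prime_primroot_def)
  obtain a where a: "p = 2 * a + 1" using assms by (elim oddE)
  \<comment> \<open>Since \<open>2 * a + 1 = p\<close>, the congruence forces
    \<open>p dvd 2 * q + 1\<close>. Discarding \<open>q\<close> up to \<open>p + 3\<close> ensures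
    both \<open>q > 3\<close> and \<open>2 * q + 1 > p\<close>, so that the divisor is
    proper.\<close>
  define S where "S = {q. prime q \<and> [q = a] (mod p)} - {..p + 3}"
  have "\<not> p dvd a" using a p2 by (auto dest: dvd_imp_le)
  hence "infinite S" unfolding S_def
    using odd_prime_primroot.infinite_primes_cong[OF primroot] by (intro Diff_infinite_finite) auto
  moreover have "prime q \<and> 2 * q \<notin> totient ` {n. 0 < n} \<and> p dvd 2 * q + 1" if "q \<in> S" for q
  proof -
    have q: "prime q" "[q = a] (mod p)" "q > p + 3" using that by (auto simp: S_def)
    have "[2 * q + 1 = 2 * a + 1] (mod p)" by (intro cong_add cong_mult cong_refl q)
    hence dvd: "p dvd 2 * q + 1" using a cong_dvd_iff[of "2 * q + 1" p p] by simp
    moreover have "\<not> prime (2 * q + 1)"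
      using dvd assms q primes_dvd_imp_eq[of p "2 * q + 1"] by auto
    hence "totient n \<noteq> 2 * q" if "n > 0" for n using q double_prime_not_totient[of q n] that by simp
    hence "2 * q \<notin> totient ` {n. 0 < n}" by (metis (mono_tags) imageE mem_Collect_eq)
    ultimately show ?thesis using q by blast
  qed
  ultimately show ?thesis by blast
qed

end
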